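(* Let $m,n\ge 1$ be integers and let $M=2^b$ for an integer $b$, with $M\ge 4$. Let $\mathcal S=\mathcal S_M=\{s_1,\dots,s_M\}$ be the $M$-PSK symbol set, $s_j=e^{\mathbf i\,2(j-1)\pi/M}$. Let $x^*\in\mathcal S_M^n$, $\mathbf H\in\mathbb C^{m\times n}$ and $v\in\mathbb C^m$ be random and put $r=\mathbf Hx^*+v$. Assume that (a) the entries of $x^*$ are drawn from $\mathcal S_M$ uniformly and independently; (b) $x^*$, $\mathbf H$ and $v$ are mutually independent; and (c) the distributions of $\mathbf H$ and $v$ are continuous (i.e. absolutely continuous with respect to Lebesgue measure on $\mathbb C^{m\times n}$ and $\mathbb C^m$, respectively). Then the relaxation (ESDR1-T) built from $\mathbf H$, $r$ and the symbols $s_1,\dots,s_M$ satisfies $$\mathbf{Prob}\big(\text{(ESDR1-T) is tight}\big)\le\left(\frac{2}{M}\right)^n .$$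
   Context: Notation: $(\cdot)^\dagger$ is the conjugate transpose, $(\cdot)^{\mathsf T}$ the transpose; $\mathrm{Re},\mathrm{Im}$ act entrywise; $\mathrm{diag}(\mathbf A)$ is the vector of diagonal entries of $\mathbf A$; $\otimes$ is the Kronecker product; $\mathbf A\succeq\mathbf B$ means that $\mathbf A-\mathbf B$ is positive semidefinite; $\langle \mathbf A,\mathbf B\rangle=\mathrm{Re}(\mathrm{Tr}(\mathbf A^\dagger\mathbf B))$. Let $s=(s_1,\dots,s_M)^{\mathsf T}\in\mathbb C^M$, $s_R=\mathrm{Re}(s)$, $s_I=\mathrm{Im}(s)$, $\mathbf Q=\mathbf H^\dagger\mathbf H$, $c=-\mathbf H^\dagger r$, and $$\hat{\mathbf S}=\begin{bmatrix}\mathbf I_n\otimes s_R^{\mathsf T}\\ \mathbf I_n\otimes s_I^{\mathsf T}\end{bmatrix}\in\mathbb R^{2n\times Mn},\quad \hat{\mathbf Q}=\begin{bmatrix}\mathrm{Re}(\mathbf Q)&-\mathrm{Im}(\mathbf Q)\\ \mathrm{Im}(\mathbf Q)&\mathrm{Re}(\mathbf Q)\end{bmatrix},\quad \hat c=\begin{bmatrix}\mathrm{Re}(c)\\ \mathrm{Im}(c)\end{bmatrix},\quad \bar{\mathbf Q}=\hat{\mathbf S}^{\mathsf T}\hat{\mathbf Q}\hat{\mathbf S},\quad \bar c=\hat{\mathbf S}^{\mathsf T}\hat c .$$ (ESDR1-T) is the semidefinite program in the variables $t=[t_1^{\mathsf T},\dots,t_n^{\mathsf T}]^{\mathsf T}\in\mathbb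 R^{Mn}$ with blocks $t_i=(t_{i,1},\dots,t_{i,M})^{\mathsf T}\in\mathbb R^M$, and symmetric $\mathbf T\in\mathbb R^{Mn\times Mn}$, partitioned into $n\times n$ blocks $\mathbf T_{i,j}\in\mathbb R^{M\times M}$: minimize $\langle\bar{\mathbf Q},\mathbf T\rangle+2\bar c^{\mathsf T}t$ subject to $t_{i,j}\ge 0$ and $\sum_{j=1}^M t_{i,j}=1$ for all $i,j$; $\mathrm{diag}(\mathbf T_{i,i})=t_i$ for $i=1,\dots,n$; $\mathbf T\succeq tt^{\mathsf T}$. Write $x_i^*=s_{u_i}$ with $u_i\in\{1,\dots,M\}$, and define $t^*\in\mathbb R^{Mn}$ by $t^*_{i,u_i}=1$ and $t^*_{i,j}=0$ for $j\ne u_i$. (ESDR1-T) is called tight if $(t,\mathbf T)=(t^*,t^*(t^* )^{\mathsf T})$ is an optimal solution of it; uniqueness of the optimal solution is not required. *)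

theory Defs
  imports "HOL-Probability.Probability"
begin

text \<open>
  The dimensions \<open>m\<close>, \<open>n\<close> and \<open>M\<close> are the cardinalities of the index types \<open>'m\<close>, \<open>'n\<close> and \<open>'k\<close>.
  Vectors in \<open>\<real>\<^bsup>Mn\<^esup>\<close> are indexed by pairs in \<open>'n \<times> 'k\<close>: the pair \<open>(i, j)\<close> is entry \<open>j\<close> of
  block \<open>i\<close>. Vectors in \<open>\<real>\<^bsup>2n\<^esup>\<close> are indexed by \<open>'n + 'n\<close>.
\<close>

definition ctranspose :: "complex^'c^'r \<Rightarrow> complex^'r^'c" where
  "ctranspose A = (\<chi> i j. cnj (A $ j $ i))"

definition Re_vec :: "complex^'c \<Rightarrow> real^'c" where
  "Re_vec x = (\<chi> i. Re (x $ i))"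

definition Im_vec :: "complex^'c \<Rightarrow> real^'c" where
  "Im_vec x = (\<chi> i. Im (x $ i))"

definition Re_mat :: "complex^'c^'r \<Rightarrow> real^'c^'r" where
  "Re_mat A = (\<chi> i j. Re (A $ i $ j))"

definition Im_mat :: "complex^'c^'r \<Rightarrow> real^'c^'r" where
  "Im_mat A = (\<chi> i j. Im (A $ i $ j))"

definition diag_vec :: "real^'c^'c \<Rightarrow> real^'c" where
  "diag_vec A = (\<chi> i. A $ i $ i)"

definition outer :: "real^'r \<Rightarrow> real^'c \<Rightarrow> real^'c^'r" where
  "outer x y = (\<chi> i j. x $ i * y $ j)"

definition psd :: "real^'c^'c \<Rightarrow> bool" where
  "psd A \<longleftrightarrow> transpose A = A \<and> (\<forall>x. 0 \<le> x \<bullet> (A *v x))"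

definition loewner_ge :: "real^'c^'c \<Rightarrow> real^'c^'c \<Rightarrow> bool" where
  "loewner_ge A B \<longleftrightarrow> psd (A - B)"

definition mat_inner :: "real^'c^'r \<Rightarrow> real^'c^'r \<Rightarrow> real" where
  "mat_inner A B = trace (transpose A ** B)"

text \<open>The Kronecker product of \<open>A\<close> with the row \<open>b\<close>, whose single row index is dropped.\<close>

definition kron_row :: "real^'c^'r \<Rightarrow> real^'k \<Rightarrow> real^('c::finite \<times> 'k::finite)^'r" where
  "kron_row A b = (\<chi> i p. A $ i $ fst p * b $ snd p)"

definition vstack :: "'a^'p \<Rightarrow> 'a^'q \<Rightarrow> 'a^('p::finite + 'q::finite)" where
  "vstack x y = (\<chi> a. case a of Inl i \<Rightarrow> x $ i | Inr i \<Rightarrow> y $ i)"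

definition hstack :: "'a^'c^'r \<Rightarrow> 'a^'d^'r \<Rightarrow> 'a^('c::finite + 'd::finite)^'r" where
  "hstack A B = (\<chi> i. vstack (A $ i) (B $ i))"


definition S_hat :: "complex^'k \<Rightarrow> real^('n::finite \<times> 'k::finite)^('n::finite + 'n)" where
  "S_hat s = vstack (kron_row (mat 1) (Re_vec s)) (kron_row (mat 1) (Im_vec s))"

definition Q_mat :: "complex^'n^'m \<Rightarrow> complex^'n^'n" where
  "Q_mat H = ctranspose H ** H"

definition c_vec :: "complex^'n^'m \<Rightarrow> complex^'m \<Rightarrow> complex^'n" where
  "c_vec H r = - (ctranspose H *v r)"

definition Q_hat :: "complex^'n^'m \<Rightarrow> real^('n::finite + 'n)^('n::finite + 'n)" where
  "Q_hat H = vstack (hstack (Re_mat (Q_mat H)) (- Im_mat (Q_mat H)))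
                    (hstack (Im_mat (Q_mat H)) (Re_mat (Q_mat H)))"

definition c_hat :: "complex^'n^'m \<Rightarrow> complex^'m \<Rightarrow> real^('n::finite + 'n)" where
  "c_hat H r = vstack (Re_vec (c_vec H r)) (Im_vec (c_vec H r))"

definition Q_bar :: "complex^'k \<Rightarrow> complex^'n^'m \<Rightarrow> real^('n::finite \<times> 'k::finite)^('n::finite \<times> 'k::finite)" where
  "Q_bar s H = transpose (S_hat s) ** Q_hat H ** S_hat s"

definition c_bar :: "complex^'k \<Rightarrow> complex^'n^'m \<Rightarrow> complex^'m \<Rightarrow> real^('n::finite \<times> 'k::finite)" where
  "c_bar s H r = transpose (S_hat s) *v c_hat H r"

definition vec_block :: "real^('n::finite \<times> 'k::finite) \<Rightarrow> 'n \<Rightarrow> real^'k" where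
  "vec_block t i = (\<chi> j. t $ (i, j))"

definition mat_block :: "real^('n::finite \<times> 'k::finite)^('n::finite \<times> 'k::finite) \<Rightarrow> 'n \<Rightarrow> 'n \<Rightarrow> real^'k^'k" where
  "mat_block T i i' = (\<chi> j j'. T $ (i, j) $ (i', j'))"

definition esdr1t_objective ::
    "complex^'k \<Rightarrow> complex^'n^'m \<Rightarrow> complex^'m \<Rightarrow> real^('n::finite \<times> 'k::finite) \<Rightarrow> real^('n::finite \<times> 'k::finite)^('n::finite \<times> 'k::finite) \<Rightarrow> real" where
  "esdr1t_objective s H r t T = mat_inner (Q_bar s H) T + 2 * (c_bar s H r \<bullet> t)"

definition esdr1t_feasible :: "real^('n::finite \<times> 'k::finite) \<Rightarrow> real^('n::finite \<times> 'k::finite)^('n::finite \<times> 'k::finite) \<Rightarrow> bool" where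
  "esdr1t_feasible t T \<longleftrightarrow>
     transpose T = T \<and>
     (\<forall>i j. 0 \<le> vec_block t i $ j) \<and>
     (\<forall>i. (\<Sum>j\<in>UNIV. vec_block t i $ j) = 1) \<and>
     (\<forall>i. diag_vec (mat_block T i i) = vec_block t i) \<and>
     loewner_ge T (outer t t)"

definition esdr1t_optimal ::
    "complex^'k \<Rightarrow> complex^'n^'m \<Rightarrow> complex^'m \<Rightarrow> real^('n::finite \<times> 'k::finite) \<Rightarrow> real^('n::finite \<times> 'k::finite)^('n::finite \<times> 'k::finite) \<Rightarrow> bool" where
  "esdr1t_optimal s H r t T \<longleftrightarrow>
     esdr1t_feasible t T \<and>
     (\<forall>t' T'. esdr1t_feasible t' T' \<longrightarrow> esdr1t_objective s H r t T \<le> esdr1t_objective s H r t' T')"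

text \<open>
  The description \<open>THE j. x $ i = s $ j\<close> is the index \<open>u\<^sub>i\<close>; it is meaningful when the symbols are
  pairwise distinct and every entry of \<open>x\<close> is a symbol.
\<close>

definition t_star :: "complex^'k \<Rightarrow> complex^'n \<Rightarrow> real^('n::finite \<times> 'k::finite)" where
  "t_star s x = (\<chi> p. if snd p = (THE j. x $ fst p = s $ j) then 1 else 0)"

definition esdr1t_tight :: "complex^'k \<Rightarrow> complex^'n^'m \<Rightarrow> complex^'m \<Rightarrow> complex^'n \<Rightarrow> bool" where
  "esdr1t_tight s H r x \<longleftrightarrow> esdr1t_optimal s H r (t_star s x) (outer (t_star s x) (t_star s x))"


text \<open>
  The order on \<open>'k\<close> only serves to number the symbols: \<open>card {i. i < j}\<close> is the zero-based position
  of \<open>j\<close>, so it plays the role of \<open>j - 1\<close> in \<open>s\<^sub>j = exp (2 \<pi> \<i> (j - 1) / M)\<close>.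
\<close>

definition psk :: "complex^'k::{finite,linorder}" where
  "psk = (\<chi> j. exp (\<i> * of_real (2 * real (card {i. i < j}) * pi / real CARD('k))))"

text \<open>
  Mutual independence of three random variables. \<^const>\<open>prob_space.indep_vars\<close> requires all
  variables to have the same type, so its definition is written out here for three types.
\<close>

definition (in prob_space) indep_var3 ::
    "'b measure \<Rightarrow> ('a \<Rightarrow> 'b) \<Rightarrow> 'c measure \<Rightarrow> ('a \<Rightarrow> 'c) \<Rightarrow> 'd measure \<Rightarrow> ('a \<Rightarrow> 'd) \<Rightarrow> bool" where
  "indep_var3 Mx X My Y Mz Z \<longleftrightarrow>
     random_variable Mx X \<and> random_variable My Y \<and> random_variable Mz Z \<and>
     indep_sets (\<lambda>k::nat.
         if k = 0 then {X -` A \<inter> space M | A. A \<in> sets Mx}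
         else if k = 1 then {Y -` A \<inter> space M | A. A \<in> sets My}
         else {Z -` A \<inter> space M | A. A \<in> sets Mz}) {0, 1, 2}"

end

theory Submission
  imports Defs
begin

text \<open>
  Writing \<open>T = t t\<^sup>T + D\<close> splits the objective into a least-squares term in \<open>t\<close> and a price
  \<open>\<langle>Q_bar, D\<rangle>\<close>, which vanishes when \<open>D\<close> is built from vectors \<open>p\<close> of one block with
  \<open>\<Sum>\<^sub>j p\<^sub>j s\<^sub>j = 0\<close>. Since the diagonal of \<open>D\<close> fixes the first-order displacement of \<open>t\<close>, each such \<open>D\<close>
  moves the \<open>i\<close>-th symbol for free in some direction \<open>\<Delta>\<close>, and tightness forces
  \<open>Re (cnj z\<^sub>i * \<Delta>) \<le> 0\<close> for \<open>z = H\<^sup>\<dagger> v\<close>. The direction towards the opposite symbol and, for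
  \<open>M \<ge> 8\<close>, one explicit direction and its mirror image confine \<open>arg (z\<^sub>i / x\<^sub>i)\<close> to
  \<open>[- 2\<pi>/M, 2\<pi>/M]\<close>. For almost every \<open>(H, v)\<close> only two symbols are compatible with this, so at most
  \<open>2\<^sup>n\<close> of the \<open>M\<^sup>n\<close> equally likely values of \<open>x\<close>, which is independent of \<open>(H, v)\<close>, can be tight.
\<close>

subsection \<open>The objective as a quadratic form\<close>

text \<open>The complex vector that the weights \<open>t\<close> stand for, block by block. It is
  the complex form of \<open>S_hat s *v t\<close>, so the stacked real matrices drop out of all
  later arguments.\<close>

definition symbol_mix :: "complex^'k \<Rightarrow> real^('n::finite \<times> 'k::finite) \<Rightarrow> complex^'n" where
  "symbol_mix s t = (\<chi> i. \<Sum>j\<in>UNIV. of_real (t $ (i, j)) * s $ j)"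

lemma vstack_nth [simp]: "vstack x y $ Inl i = x $ i" "vstack x y $ Inr k = y $ k"
  by (simp_all add: vstack_def)

lemma vec_eq_iff_sum:
  fixes x y :: "'a^('p::finite + 'q::finite)"
  shows "x = y \<longleftrightarrow> (\<forall>i. x $ Inl i = y $ Inl i) \<and> (\<forall>i. x $ Inr i = y $ Inr i)"
  unfolding vec_eq_iff by (metis old.sum.exhaust)

lemma sum_UNIV_sum_type:
  fixes f :: "'p::finite + 'q::finite \<Rightarrow> 'a::comm_monoid_add"
  shows "sum f UNIV = (\<Sum>i\<in>UNIV. f (Inl i)) + (\<Sum>i\<in>UNIV. f (Inr i))"
  unfolding UNIV_Plus_UNIV[symmetric] by (subst sum.Plus) auto

lemma sum_UNIV_prod_type:
  fixes f :: "'p::finite \<times> 'q::finite \<Rightarrow> 'a::comm_monoid_add"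
  shows "sum f UNIV = (\<Sum>i\<in>UNIV. \<Sum>j\<in>UNIV. f (i, j))"
  unfolding UNIV_Times_UNIV[symmetric] by (subst sum.cartesian_product) auto

lemma inner_vstack:
  fixes a c :: "real^'p" and b d :: "real^'q"
  shows "vstack a b \<bullet> vstack c d = a \<bullet> c + b \<bullet> d"
  by (simp add: inner_vec_def sum_UNIV_sum_type)

lemma S_hat_mult:
  "S_hat s *v t = vstack (Re_vec (symbol_mix s t)) (Im_vec (symbol_mix s t))"
proof -
  have *: "(\<Sum>i'\<in>UNIV. \<Sum>j\<in>UNIV. t $ (i', j) * (g j * (if i = i' then 1 else 0))) =
      (\<Sum>j\<in>UNIV. g j * t $ (i, j))" for i and g :: "'b \<Rightarrow> real"
  proof -
    have "(\<Sum>i'\<in>UNIV. \<Sum>j\<in>UNIV. t $ (i', j) * (g j * (if i = i' then 1 else 0))) =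
        (\<Sum>i'\<in>UNIV. if i = i' then (\<Sum>j\<in>UNIV. g j * t $ (i', j)) else 0)"
      by (intro sum.cong) (auto simp: mult.commute)
    then show ?thesis by (simp add: mult.commute)
  qed
  show ?thesis
    unfolding vec_eq_iff_sum
    by (auto simp: matrix_vector_mult_def S_hat_def kron_row_def mat_def Re_vec_def Im_vec_def
        symbol_mix_def sum_UNIV_prod_type * mult.commute intro!: sum.cong)
qed

text \<open>Stacking real and imaginary parts turns a complex matrix into the real block matrix with
  rows (Re, -Im) and (Im, Re), which is the shape of \<open>Q_hat\<close>.\<close>

lemma Q_hat_mult:
  "Q_hat H *v vstack (Re_vec x) (Im_vec x) =
     vstack (Re_vec (Q_mat H *v x)) (Im_vec (Q_mat H *v x))"
  unfolding vec_eq_iff_sum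
  by (auto simp: matrix_vector_mult_def Q_hat_def hstack_def Re_mat_def Im_mat_def Re_vec_def
      Im_vec_def sum_UNIV_sum_type sum.distrib sum_negf sum_subtractf)

lemma inner_Re_Im_vec: "Re_vec x \<bullet> Re_vec y + Im_vec x \<bullet> Im_vec y = x \<bullet> y"
  by (simp add: inner_vec_def Re_vec_def Im_vec_def inner_complex_def sum.distrib)

lemma inner_complex_Re: "x \<bullet> y = Re (cnj x * y)"
  by (simp add: inner_complex_def)

text \<open>The inner product here is the real part of the Hermitian one; the conjugate transpose is
  its adjoint as well.\<close>

lemma inner_ctranspose: "x \<bullet> (ctranspose H *v y) = (H *v x) \<bullet> y"
proof -
  have "x \<bullet> (ctranspose H *v y) = (\<Sum>i\<in>UNIV. \<Sum>k\<in>UNIV. Re (cnj (x $ i) * (cnj (H $ k $ i) * y $ k)))"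
    by (simp add: inner_vec_def inner_complex_Re matrix_vector_mult_def ctranspose_def
        sum_distrib_left del: times_complex.sel complex_cnj_mult)
  also have "\<dots> = (\<Sum>k\<in>UNIV. \<Sum>i\<in>UNIV. Re (cnj (x $ i) * (cnj (H $ k $ i) * y $ k)))"
    by (rule sum.swap)
  also have "\<dots> = (\<Sum>k\<in>UNIV. Re (cnj (\<Sum>i\<in>UNIV. H $ k $ i * x $ i) * y $ k))"
    by (simp add: sum_distrib_right sum_distrib_left cnj_sum mult_ac flip: Re_sum
        del: times_complex.sel)
  also have "\<dots> = (H *v x) \<bullet> y"
    by (simp add: inner_vec_def inner_complex_Re matrix_vector_mult_def)
  finally show ?thesis .
qed

lemma inner_Q_mat: "x \<bullet> (Q_mat H *v y) = (H *v x) \<bullet> (H *v y)"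
  by (simp add: Q_mat_def inner_ctranspose flip: matrix_vector_mul_assoc)

lemma inner_transpose_mult:
  fixes A :: "real^'c^'r"
  shows "x \<bullet> (transpose A *v y) = (A *v x) \<bullet> y"
  by (metis dot_lmul_matrix inner_commute transpose_matrix_vector)

lemma mat_inner_outer: "mat_inner A (outer a b) = a \<bullet> (A *v b)"
proof -
  have "mat_inner A (outer a b) = (\<Sum>j\<in>UNIV. \<Sum>i\<in>UNIV. A $ i $ j * (a $ i * b $ j))"
    by (simp add: mat_inner_def outer_def trace_def matrix_matrix_mult_def transpose_def)
  also have "\<dots> = (\<Sum>i\<in>UNIV. \<Sum>j\<in>UNIV. A $ i $ j * (a $ i * b $ j))"
    by (rule sum.swap)
  also have "\<dots> = a \<bullet> (A *v b)"
    by (simp add: inner_vec_def matrix_vector_mult_def sum_distrib_left algebra_simps)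
  finally show ?thesis .
qed

lemma mat_inner_add: "mat_inner A (B + C) = mat_inner A B + mat_inner A C"
  by (simp add: mat_inner_def matrix_add_ldistrib trace_add)

lemma mat_inner_scaleR: "mat_inner A (c *\<^sub>R B) = c * mat_inner A B"
  by (simp add: mat_inner_def trace_def matrix_matrix_mult_def sum_distrib_left algebra_simps)

text \<open>This is the source of the free directions: a rank-one matrix costs nothing as soon as
  one of its factors mixes the symbols to zero.\<close>

lemma mat_inner_Q_bar:
  "mat_inner (Q_bar s H) (outer a b) = (H *v symbol_mix s a) \<bullet> (H *v symbol_mix s b)"
proof -
  have "mat_inner (Q_bar s H) (outer a b) = (S_hat s *v a) \<bullet> (Q_hat H *v (S_hat s *v b))"
    by (simp add: mat_inner_outer Q_bar_def inner_transpose_mult del: transpose_matrix_vector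
        flip: matrix_vector_mul_assoc)
  then show ?thesis
    by (simp add: S_hat_mult Q_hat_mult inner_vstack inner_Re_Im_vec inner_Q_mat)
qed

lemma inner_c_bar: "c_bar s H r \<bullet> t = - (r \<bullet> (H *v symbol_mix s t))"
proof -
  have "c_bar s H r \<bullet> t = (S_hat s *v t) \<bullet> c_hat H r"
    by (simp add: c_bar_def inner_commute[of _ t] inner_transpose_mult del: transpose_matrix_vector)
  then show ?thesis
    by (simp add: S_hat_mult c_hat_def inner_vstack inner_Re_Im_vec c_vec_def inner_ctranspose
        inner_commute)
qed

subsection \<open>First-order optimality\<close>

definition diag_mat :: "real^'c \<Rightarrow> real^'c^'c" where
  "diag_mat d = (\<chi> i j. if i = j then d $ i else 0)"

lemma diag_mat_mult: "diag_mat d *v x = (\<chi> i. d $ i * x $ i)"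
proof -
  have "(\<Sum>j\<in>UNIV. (if i = j then d $ i else 0) * x $ j) = d $ i * x $ i" for i
    by (subst sum.remove[of _ i]) (auto intro!: sum.neutral)
  then show ?thesis
    by (simp add: matrix_vector_mult_def diag_mat_def vec_eq_iff)
qed

lemma outer_mult: "outer a b *v x = (b \<bullet> x) *\<^sub>R a"
  by (simp add: vec_eq_iff outer_def matrix_vector_mult_def inner_vec_def sum_distrib_left
      sum_distrib_right mult_ac)

section \<open>Feasible perturbations of a rank-one point\<close>

lemma psd_outer: "psd (outer a a)"
  by (simp add: psd_def outer_mult) (simp add: outer_def transpose_def vec_eq_iff inner_commute mult.commute)

lemma psd_add: "psd A \<Longrightarrow> psd B \<Longrightarrow> psd (A + B)"
  by (auto simp: psd_def matrix_vector_mult_add_rdistrib inner_add_right transpose_def vec_eq_iff)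

lemma psd_scaleR: "psd A \<Longrightarrow> 0 \<le> c \<Longrightarrow> psd (c *\<^sub>R A)"
  by (auto simp: psd_def transpose_def vec_eq_iff scaleR_matrix_vector_assoc[symmetric])

text \<open>Weighted Cauchy-Schwarz: each term of \<open>m \<bullet> x\<close> is split into a
  factor \<open>sqrt \<bar>m $ e\<bar>\<close> and a factor carrying the sign and
  \<open>x $ e\<close>. The squares of the first factors sum to the scalar in front.\<close>

lemma sum_abs_diag_ge_outer:
  fixes m :: "real^'c"
  shows "psd ((\<Sum>e\<in>UNIV. \<bar>m $ e\<bar>) *\<^sub>R diag_mat (\<chi> e. \<bar>m $ e\<bar>) - outer m m)"
proof -
  let ?S = "\<Sum>e\<in>UNIV. \<bar>m $ e\<bar>" and ?E = "diag_mat (\<chi> e. \<bar>m $ e\<bar>)"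
  have "0 \<le> x \<bullet> ((?S *\<^sub>R ?E - outer m m) *v x)" for x
  proof -
    have "(m \<bullet> x)\<^sup>2 = (\<Sum>e\<in>UNIV. sqrt \<bar>m $ e\<bar> * (sgn (m $ e) * sqrt \<bar>m $ e\<bar> * x $ e))\<^sup>2"
      unfolding inner_vec_def
      by (intro arg_cong[where f = "\<lambda>z. z\<^sup>2"] sum.cong refl)
        (simp add: sgn_if abs_if)
    also have "\<dots> \<le> (\<Sum>e\<in>UNIV. (sqrt \<bar>m $ e\<bar>)\<^sup>2) *
        (\<Sum>e\<in>UNIV. (sgn (m $ e) * sqrt \<bar>m $ e\<bar> * x $ e)\<^sup>2)"
      by (rule Cauchy_Schwarz_ineq_sum)
    also have "\<dots> = ?S * (\<Sum>e\<in>UNIV. \<bar>m $ e\<bar> * (x $ e)\<^sup>2)"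
      by (intro arg_cong2[where f = "(*)"] sum.cong refl)
        (auto simp: power_mult_distrib sgn_if)
    also have "\<dots> = ?S * (x \<bullet> (?E *v x))"
      by (simp add: diag_mat_mult inner_vec_def power2_eq_square mult_ac)
    finally show ?thesis
      by (simp add: matrix_vector_mult_diff_rdistrib inner_diff_right outer_mult
          scaleR_matrix_vector_assoc[symmetric] power2_eq_square inner_commute[of x m])
  qed
  then show ?thesis
    by (auto simp: psd_def transpose_def vec_eq_iff diag_mat_def outer_def mult.commute)
qed

text \<open>
  The summand \<open>\<epsilon> D\<close> alone does not dominate the rank-one term \<open>\<epsilon>\<^sup>2 m m\<^sup>T\<close>. Mixing in the diagonal matrix
  \<open>E\<close> with weight \<open>S \<epsilon>\<close> repairs this without changing the diagonal, at second-order cost.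
\<close>

lemma esdr1t_feasible_perturb:
  fixes t m :: "real^('n::finite \<times> 'k::finite)"
  defines "S \<equiv> \<Sum>e\<in>UNIV. \<bar>m $ e\<bar>" and "E \<equiv> diag_mat (\<chi> e. \<bar>m $ e\<bar>)"
  assumes t01: "\<And>e. t $ e = 0 \<or> t $ e = 1" and t1: "\<And>i. (\<Sum>j\<in>UNIV. t $ (i, j)) = 1"
    and m0: "\<And>e. t $ e = 0 \<Longrightarrow> 0 \<le> m $ e" and m1: "\<And>e. t $ e = 1 \<Longrightarrow> m $ e \<le> 0"
    and sum0: "\<And>i. (\<Sum>j\<in>UNIV. m $ (i, j)) = 0"
    and D: "psd D" "\<And>e. D $ e $ e = \<bar>m $ e\<bar>"
    and \<epsilon>: "0 \<le> \<epsilon>" "S * \<epsilon> \<le> 1"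
  shows "esdr1t_feasible (t + \<epsilon> *\<^sub>R m)
    (outer t t + \<epsilon> *\<^sub>R (outer t m + outer m t) + \<epsilon> *\<^sub>R ((1 - S * \<epsilon>) *\<^sub>R D + (S * \<epsilon>) *\<^sub>R E))"
    (is "esdr1t_feasible ?t ?T")
proof -
  have tD: "D $ e $ f = D $ f $ e" for e f
  proof -
    have "transpose D $ f $ e = D $ f $ e" using D(1) by (simp add: psd_def)
    then show ?thesis by (simp add: transpose_def)
  qed
  have "transpose ?T = ?T"
    by (simp add: transpose_def vec_eq_iff outer_def E_def diag_mat_def tD algebra_simps)
  moreover have "0 \<le> ?t $ e" for e
  proof (cases "t $ e = 0")
    case True
    then show ?thesis using m0 \<epsilon> by simp
  next
    case False
    then have "t $ e = 1" using t01 by blast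
    moreover have "\<bar>m $ e\<bar> \<le> S" unfolding S_def by (rule member_le_sum) auto
    then have "\<epsilon> * \<bar>m $ e\<bar> \<le> 1" using \<epsilon> 
      by (metis mult.commute mult_left_mono order_trans)
    then have "- 1 \<le> \<epsilon> * m $ e" using \<epsilon>(1) by (simp add: abs_if split: if_splits) (smt (verit) mult_nonneg_nonneg)
    ultimately show ?thesis by simp
  qed
  moreover have "(\<Sum>j\<in>UNIV. ?t $ (i, j)) = 1" for i
    by (simp add: sum.distrib t1 sum0 flip: sum_distrib_left)
  \<comment> \<open>At a zero of \<open>t\<close> the cross terms vanish and
    \<open>\<bar>m $ e\<bar> = m $ e\<close>. At a one they contribute
    \<open>2 * \<epsilon> * m $ e\<close>, of which \<open>\<epsilon> * \<bar>m $ e\<bar>\<close>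
    takes back half. This is why the diagonal of \<open>D\<close> must be
    \<open>\<bar>m $ e\<bar>\<close>.\<close>
  moreover have "?T $ e $ e = ?t $ e" for e
    using t01[of e]
  proof
    assume "t $ e = 0"
    then show ?thesis using m0[of e] by (simp add: outer_def E_def diag_mat_def D algebra_simps)
  next
    assume "t $ e = 1"
    then show ?thesis using m1[of e] by (simp add: outer_def E_def diag_mat_def D algebra_simps)
  qed
  moreover have "psd (?T - outer ?t ?t)"
  proof -
    \<comment> \<open>The cross terms cancel; the remaining negative term is of order
      \<open>\<epsilon>\<^sup>2\<close> and is absorbed by the share of \<open>E\<close>.\<close>
    have "?T - outer ?t ?t = (\<epsilon> * (1 - S * \<epsilon>)) *\<^sub>R D + \<epsilon>\<^sup>2 *\<^sub>R (S *\<^sub>R E - outer m m)"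
      by (simp add: vec_eq_iff outer_def algebra_simps power2_eq_square)
    moreover have "psd (S *\<^sub>R E - outer m m)"
      unfolding S_def E_def by (rule sum_abs_diag_ge_outer)
    ultimately show ?thesis
      using D(1) \<epsilon> by (simp add: psd_add psd_scaleR)
  qed
  ultimately show ?thesis
    by (simp add: esdr1t_feasible_def vec_block_def mat_block_def diag_vec_def vec_eq_iff
        loewner_ge_def)
qed

lemma symbol_mix_add: "symbol_mix s (a + b) = symbol_mix s a + symbol_mix s b"
  and symbol_mix_scaleR: "symbol_mix s (c *\<^sub>R a) = c *\<^sub>R symbol_mix s a"
   apply (simp add: symbol_mix_def vec_eq_iff sum.distrib distrib_right)
  apply (simp add: symbol_mix_def vec_eq_iff scaleR_sum_right)
  apply (simp add: scaleR_conv_of_real mult_ac)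
  done

text \<open>Along the feasible curve of \<open>esdr1t_feasible_perturb\<close> the objective changes
  by \<open>\<epsilon> * (2 * ?G + \<epsilon> * K)\<close>, since \<open>D\<close> is free of cost.
  A negative \<open>?G\<close> would make this negative for small \<epsilon>.\<close>

lemma esdr1t_optimal_first_order:
  fixes t m :: "real^('n::finite \<times> 'k::finite)"
  assumes opt: "esdr1t_optimal s H r t (outer t t)"
    and t01: "\<And>e. t $ e = 0 \<or> t $ e = 1"
    and m0: "\<And>e. t $ e = 0 \<Longrightarrow> 0 \<le> m $ e" and m1: "\<And>e. t $ e = 1 \<Longrightarrow> m $ e \<le> 0"
    and sum0: "\<And>i. (\<Sum>j\<in>UNIV. m $ (i, j)) = 0"
    and D: "psd D" "\<And>e. D $ e $ e = \<bar>m $ e\<bar>" "mat_inner (Q_bar s H) D = 0"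
  shows "0 \<le> (H *v symbol_mix s t - r) \<bullet> (H *v symbol_mix s m)" (is "0 \<le> ?G")
proof (rule ccontr)
  assume G: "\<not> 0 \<le> ?G"
  define S where "S = (\<Sum>e\<in>UNIV. \<bar>m $ e\<bar>)"
  define E where "E = diag_mat (\<chi> e. \<bar>m $ e\<bar>)"
  define K where "K = S * mat_inner (Q_bar s H) E"
  have S: "0 \<le> S" by (simp add: S_def sum_nonneg)
  have t1: "(\<Sum>j\<in>UNIV. t $ (i, j)) = 1" for i
    using opt by (simp add: esdr1t_optimal_def esdr1t_feasible_def vec_block_def)
  have key: "0 \<le> 2 * ?G + \<epsilon> * K" if \<epsilon>: "0 < \<epsilon>" "S * \<epsilon> \<le> 1" for \<epsilon>
  proof -
    let ?t = "t + \<epsilon> *\<^sub>R m"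
    let ?T = "outer t t + \<epsilon> *\<^sub>R (outer t m + outer m t) + \<epsilon> *\<^sub>R ((1 - S * \<epsilon>) *\<^sub>R D + (S * \<epsilon>) *\<^sub>R E)"
    have "esdr1t_feasible ?t ?T"
      unfolding S_def E_def
      by (rule esdr1t_feasible_perturb) (use t01 t1 m0 m1 sum0 D \<epsilon> in \<open>auto simp: S_def\<close>)
    then have "esdr1t_objective s H r t (outer t t) \<le> esdr1t_objective s H r ?t ?T"
      using opt by (simp add: esdr1t_optimal_def)
    then have "0 \<le> \<epsilon> * (2 * ?G + \<epsilon> * K)"
      by (simp add: esdr1t_objective_def mat_inner_add mat_inner_scaleR mat_inner_Q_bar D(3)
          inner_c_bar symbol_mix_add symbol_mix_scaleR K_def matrix_vector_right_distrib
          matrix_vector_mult_scaleR inner_add_right inner_diff_left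
          inner_commute[of "H *v symbol_mix s m"]) (simp add: algebra_simps)
    then show ?thesis
      using \<epsilon> by (simp add: zero_le_mult_iff)
  qed
  \<comment> \<open>The first bound keeps \<open>S * \<epsilon> \<le> 1\<close>; the second gives
    \<open>\<epsilon> * K \<le> - ?G\<close>, so that
    \<open>2 * ?G + \<epsilon> * K \<le> ?G < 0\<close>. The added ones keep the denominators
    positive.\<close>
  define \<epsilon> where "\<epsilon> = min (1 / (S + 1)) (- ?G / (\<bar>K\<bar> + 1))"
  have "0 < \<epsilon>" using G S by (auto simp: \<epsilon>_def intro!: divide_pos_pos divide_neg_pos)
  have "S * \<epsilon> \<le> S * (1 / (S + 1))" using S by (intro mult_left_mono) (auto simp: \<epsilon>_def)
  also have "\<dots> \<le> 1" using S by simp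
  finally have "S * \<epsilon> \<le> 1" .
  have "\<epsilon> * K \<le> \<epsilon> * (\<bar>K\<bar> + 1)" using \<open>0 < \<epsilon>\<close> by (intro mult_left_mono) auto
  also have "\<dots> \<le> - ?G / (\<bar>K\<bar> + 1) * (\<bar>K\<bar> + 1)"
    by (intro mult_right_mono) (auto simp: \<epsilon>_def)
  also have "\<dots> = - ?G" by (simp add: add_nonneg_eq_0_iff)
  finally show False
    using key[OF \<open>0 < \<epsilon>\<close> \<open>S * \<epsilon> \<le> 1\<close>] G by linarith
qed

subsection \<open>Free directions in one block\<close>

lemma t_star_nth:
  assumes "inj (($) s)" "x $ i \<in> range (($) s)"
  shows "t_star s x $ (i, j) = (if x $ i = s $ j then 1 else 0)"
proof -
  obtain u where u: "x $ i = s $ u" using assms(2) by blast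
  have "(THE j. x $ i = s $ j) = u"
    using u assms(1) by (intro the_equality) (auto dest: injD)
  then show ?thesis
    using u assms(1) by (auto simp: t_star_def dest: injD)
qed

lemma symbol_mix_t_star:
  assumes "inj (($) s)" "\<And>i. x $ i \<in> range (($) s)"
  shows "symbol_mix s (t_star s x) = x"
proof -
  have "(\<Sum>j\<in>UNIV. of_real (t_star s x $ (i, j)) * s $ j) = x $ i" for i
  proof -
    obtain u where u: "x $ i = s $ u" using assms(2) by blast
    have "(\<Sum>j\<in>UNIV. of_real (t_star s x $ (i, j)) * s $ j) = (\<Sum>j\<in>UNIV. if j = u then s $ j else 0)"
      using u by (intro sum.cong) (auto simp: t_star_nth[OF assms] dest: injD[OF assms(1)])
    then show ?thesis using u by simp
  qed
  then show ?thesis by (simp add: symbol_mix_def vec_eq_iff)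
qed

text \<open>Here \<open>d\<close> is the diagonal in block \<open>i\<close> of the free matrix built
  from \<open>p\<close> and \<open>q\<close>. The displacement of \<open>t\<close> is
  \<open>d\<close> with its sign flipped at \<open>u\<close>, the only entry of the block that can
  decrease; \<open>bal\<close> says that it sums to zero. Two vectors with separate weights leave
  room to arrange this balance.\<close>

lemma esdr1t_tight_block:
  fixes s :: "complex^'k" and x :: "complex^'n" and p q :: "real^'k" and \<alpha> \<beta> :: real
  defines "d \<equiv> \<lambda>j. \<alpha> * (p $ j)\<^sup>2 + \<beta> * (q $ j)\<^sup>2"
  assumes inj: "inj (($) s)" and x: "\<And>i. x $ i \<in> range (($) s)"
    and tight: "esdr1t_tight s H (H *v x + v) x" and u: "x $ i = s $ u"
    and \<alpha>\<beta>: "0 \<le> \<alpha>" "0 \<le> \<beta>"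
    and p: "(\<Sum>j\<in>UNIV. of_real (p $ j) * s $ j) = 0"
    and q: "(\<Sum>j\<in>UNIV. of_real (q $ j) * s $ j) = 0"
    and bal: "(\<Sum>j\<in>UNIV. d j) = 2 * d u"
  shows "(ctranspose H *v v) $ i \<bullet> ((\<Sum>j\<in>UNIV. of_real (d j) * s $ j) - of_real (2 * d u) * s $ u) \<le> 0"
proof -
  define \<Delta> where "\<Delta> = (\<Sum>j\<in>UNIV. of_real (d j) * s $ j) - of_real (2 * d u) * s $ u"
  define emb :: "real^'k \<Rightarrow> real^('n \<times> 'k)"
    where "emb = (\<lambda>y. \<chi> e. if fst e = i then y $ snd e else 0)"
  define m :: "real^('n \<times> 'k)" where "m = emb (\<chi> j. if j = u then - d j else d j)"
  define D where "D = \<alpha> *\<^sub>R outer (emb p) (emb p) + \<beta> *\<^sub>R outer (emb q) (emb q)"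
  have d0: "0 \<le> d j" for j using \<alpha>\<beta> by (simp add: d_def)
  have t: "t_star s x $ (i', j) = (if x $ i' = s $ j then 1 else 0)" for i' j
    using t_star_nth[OF inj x] .
  have ti: "t_star s x $ (i, j) = (if j = u then 1 else 0)" for j
    using u inj by (auto simp: t dest: injD)
  have mix_emb: "symbol_mix s (emb y) = axis i (\<Sum>j\<in>UNIV. of_real (y $ j) * s $ j)" for y
    by (auto simp: symbol_mix_def emb_def vec_eq_iff axis_def)
  have "(\<Sum>j\<in>UNIV. of_real (if j = u then - d j else d j) * s $ j) =
      (\<Sum>j\<in>UNIV. of_real (d j) * s $ j - (if j = u then of_real (2 * d u) * s $ u else 0))"
    by (intro sum.cong) auto
  then have mix_m: "symbol_mix s m = axis i \<Delta>"
    by (simp add: m_def mix_emb \<Delta>_def sum_subtractf)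
  have "(\<Sum>j\<in>UNIV. if j = u then - d j else d j) = (\<Sum>j\<in>UNIV. d j - (if j = u then 2 * d u else 0))"
    by (intro sum.cong) auto
  then have sum_m: "(\<Sum>j\<in>UNIV. m $ (i', j)) = 0" for i'
    using bal by (cases "i' = i") (simp_all add: m_def emb_def sum_subtractf)
  have "0 \<le> (H *v symbol_mix s (t_star s x) - (H *v x + v)) \<bullet> (H *v symbol_mix s m)"
  proof (rule esdr1t_optimal_first_order[where D = D])
    show "esdr1t_optimal s H (H *v x + v) (t_star s x) (outer (t_star s x) (t_star s x))"
      using tight by (simp add: esdr1t_tight_def)
    show "t_star s x $ e = 0 \<or> t_star s x $ e = 1" for e
      by (cases e) (simp add: t)
    show "0 \<le> m $ e" if "t_star s x $ e = 0" for e
      using that d0 by (cases e) (auto simp: m_def emb_def ti)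
    show "m $ e \<le> 0" if "t_star s x $ e = 1" for e
      using that d0 by (cases e) (auto simp: m_def emb_def ti split: if_splits)
    show "(\<Sum>j\<in>UNIV. m $ (i', j)) = 0" for i' by (rule sum_m)
    show "psd D" using \<alpha>\<beta> by (simp add: D_def psd_add psd_scaleR psd_outer)
    show "D $ e $ e = \<bar>m $ e\<bar>" for e
      using d0[of "snd e"]
      by (auto simp: D_def m_def emb_def outer_def d_def power2_eq_square)
    show "mat_inner (Q_bar s H) D = 0"
      using p q by (simp add: D_def mat_inner_add mat_inner_scaleR mat_inner_Q_bar mix_emb axis_def
          vec_eq_iff matrix_vector_mult_def inner_vec_def)
  qed
  \<comment> \<open>The residual at the true symbols is \<open>- v\<close>, and the displacement
    lives in component \<open>i\<close> only.\<close>
  also have "\<dots> = - (axis i \<Delta> \<bullet> (ctranspose H *v v))"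
    by (simp add: symbol_mix_t_star[OF inj x] mix_m inner_ctranspose inner_commute)
  finally show ?thesis
    unfolding \<Delta>_def[symmetric] by (simp add: inner_axis' inner_commute)
qed

section \<open>Directions from the opposite symbol and from five neighbouring symbols\<close>

lemma sum_UNIV_distinct_list:
  fixes f :: "'k::finite \<Rightarrow> 'a::comm_monoid_add"
  assumes "distinct js" "\<And>j. j \<notin> set js \<Longrightarrow> f j = 0"
  shows "sum f UNIV = (\<Sum>j\<leftarrow>js. f j)"
proof -
  have "sum f UNIV = sum f (set js)"
    using assms(2) by (intro sum.mono_neutral_right) auto
  then show ?thesis
    using assms(1) by (simp add: sum_list_distinct_conv_sum_set)
qed

text \<open>The vector \<open>p\<close> with ones at \<open>u\<close> and \<open>u'\<close> mixes to
  zero and is balanced by itself. It moves the symbol by \<open>- 2 * s $ u\<close>.\<close>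

lemma esdr1t_tight_opposite:
  fixes s :: "complex^'k" and x :: "complex^'n"
  assumes inj: "inj (($) s)" and x: "\<And>i. x $ i \<in> range (($) s)"
    and tight: "esdr1t_tight s H (H *v x + v) x" and u: "x $ i = s $ u"
    and opp: "s $ u' = - s $ u" "u' \<noteq> u"
  shows "0 \<le> (ctranspose H *v v) $ i \<bullet> s $ u"
proof -
  define p :: "real^'k" where "p = (\<chi> j. if j \<in> {u, u'} then 1 else 0)"
  have sums: "(\<Sum>j\<in>UNIV. of_real (p $ j) * s $ j) = 0"
    "(\<Sum>j\<in>UNIV. 1 * (p $ j)\<^sup>2 + 0 * ((0 :: real^'k) $ j)\<^sup>2) = 2 * (1 * (p $ u)\<^sup>2 + 0 * ((0 :: real^'k) $ u)\<^sup>2)"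
    "(\<Sum>j\<in>UNIV. of_real (1 * (p $ j)\<^sup>2 + 0 * ((0 :: real^'k) $ j)\<^sup>2) * s $ j) = 0"
    using opp by (subst sum_UNIV_distinct_list[of "[u, u']"]; force simp: p_def)+
  have "(ctranspose H *v v) $ i \<bullet> (0 - of_real (2 * (1 * (p $ u)\<^sup>2 + 0 * ((0 :: real^'k) $ u)\<^sup>2)) * s $ u) \<le> 0"
    using esdr1t_tight_block[OF inj x tight u, of 1 0 p 0] sums by simp
  moreover have "2 * s $ u = 2 *\<^sub>R s $ u" by (simp add: scaleR_conv_of_real)
  ultimately show ?thesis by (simp add: p_def)
qed

text \<open>
  Up to the factor \<open>Im c\<close> in the imaginary part, these are the coordinates, relative to \<open>s\<^sub>u c\<close>, of the
  direction produced by the vectors \<open>p\<close> and \<open>q\<close> in the proof of \<open>esdr1t_tight_sector\<close>, with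
  \<open>C = Re c\<close>.
\<close>

definition drift_re :: "real \<Rightarrow> real" where
  "drift_re C = 4 * C\<^sup>2 * (1 - C) * (36 * C\<^sup>2 - 10 * C - 10)"

definition drift_im :: "real \<Rightarrow> real" where
  "drift_im C = 24 * C ^ 3 * (6 * C - 1) + 2 * (28 * C\<^sup>2 - 6 - 16 * C ^ 4)"

text \<open>The expression is the surplus at \<open>u\<close> of the vector \<open>q\<close> in
  \<open>esdr1t_tight_sector\<close>: its squared entry there minus the squares of the others. With
  \<open>t = C\<^sup>2\<close> it is at least \<open>4 * t + 2\<close>.\<close>

lemma surplus_pos:
  fixes C :: real
  assumes "1 / 2 \<le> C\<^sup>2" "C\<^sup>2 \<le> 1"
  shows "0 < 28 * C\<^sup>2 - 6 - 16 * C ^ 4"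
proof -
  define t where "t = C\<^sup>2"
  have C4: "C ^ 4 = t * t" by (simp add: t_def power2_eq_square power4_eq_xxxx)
  have "0 \<le> (2 * t - 1) * (1 - t)" using assms by (simp add: t_def)
  then have "16 * (t * t) \<le> 24 * t - 8" by (simp add: algebra_simps)
  then show ?thesis using assms unfolding C4 t_def[symmetric] by linarith
qed

text \<open>For \<open>C\<close> the cosine of the step angle, the hypotheses mean a step of at most
  \<pi>/4. The signs give the direction of \<open>esdr1t_tight_sector\<close> a nonnegative
  component along \<open>s\<^sub>u c\<close> and, for \<open>Im c > 0\<close>, a positive one across
  it.\<close>

lemma drift_pos:
  fixes C :: real
  assumes "1 / 2 \<le> C\<^sup>2" "C\<^sup>2 \<le> 1" "0 < C"
  shows "0 \<le> drift_re C" "0 < drift_im C"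
proof -
  have C1: "C \<le> 1" using assms by (simp add: abs_square_le_1 abs_if)
  have C7: "7 / 10 \<le> C"
  proof (rule ccontr)
    assume "\<not> ?thesis"
    then have "C\<^sup>2 \<le> (7 / 10)\<^sup>2" using assms by (intro power_mono) auto
    then show False using assms by (simp add: power2_eq_square)
  qed
  have "0 \<le> 36 * C\<^sup>2 - 10 * C - 10"
  \<comment> \<open>Up to \<open>4 / 5\<close> the bound \<open>36 * C\<^sup>2 \<ge> 18\<close>
    suffices; beyond it, \<open>C\<^sup>2 \<ge> (4 / 5) * C\<close> leaves a positive linear
    function.\<close>
  proof (cases "C \<le> 4 / 5")
    case True
    then show ?thesis using assms by linarith
  next
    case False
    then have "(4 / 5) * C \<le> C * C" by (intro mult_right_mono) auto
    then show ?thesis using False unfolding power2_eq_square by linarith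
  qed
  then show "0 \<le> drift_re C" using C1 by (simp add: drift_re_def)
  have "0 < 24 * C ^ 3 * (6 * C - 1)" using C7 by simp
  then show "0 < drift_im C" using surplus_pos[OF assms(1,2)] by (simp add: drift_im_def)
qed

text \<open>The five symbols sit -1, 0, 1, 2 and 3 rotations by \<open>c\<close> away from
  \<open>s $ u\<close>. Exchanging \<open>c\<close> for its conjugate gives the mirror image of the
  inequality.\<close>

lemma esdr1t_tight_sector:
  fixes s :: "complex^'k" and x :: "complex^'n"
  assumes inj: "inj (($) s)" and x: "\<And>i. x $ i \<in> range (($) s)"
    and tight: "esdr1t_tight s H (H *v x + v) x" and u: "x $ i = s $ u"
    and js: "distinct [u, j, j1, j2, j3]"
    and sj: "s $ j = s $ u * cnj c" "s $ j1 = s $ u * c" "s $ j2 = s $ u * c\<^sup>2" "s $ j3 = s $ u * c ^ 3"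
    and c: "norm c = 1" "1 / 2 \<le> (Re c)\<^sup>2"
  shows "(ctranspose H *v v) $ i \<bullet> (s $ u * c * Complex (drift_re (Re c)) (drift_im (Re c) * Im c)) \<le> 0"
proof -
  define C S where "C = Re c" and "S = Im c"
  have cCS: "c = Complex C S" by (simp add: C_def S_def)
  have S2: "S * S = 1 - C * C"
    using c(1) by (simp add: cmod_def C_def S_def power2_eq_square)
  have "C\<^sup>2 \<le> 1" using S2 zero_le_square[of S] by (simp add: power2_eq_square)
  define \<sigma> where "\<sigma> = 28 * C\<^sup>2 - 6 - 16 * C ^ 4"
  have \<sigma>: "0 \<le> \<sigma>" using surplus_pos[OF _ \<open>C\<^sup>2 \<le> 1\<close>] c(2) by (simp add: \<sigma>_def C_def)
  \<comment> \<open>Both vectors mix the symbols to zero. For \<open>p\<close> the entry at \<open>u\<close> is too small to balance the squares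
    of the others, for \<open>q\<close> it is too large; the weights \<open>\<sigma>\<close> and \<open>4 C\<^sup>2\<close> cancel deficit and surplus.\<close>
  define p :: "real^'k" where
    "p = (\<chi> k. if k = u then 1 else if k = j1 then - 2 * C else if k = j2 then 1 else 0)"
  define q :: "real^'k" where
    "q = (\<chi> k. if k = u then 6 * C else if k = j then - 2 else if k = j1 then - (4 * C\<^sup>2 + 1)
               else if k = j3 then 1 else 0)"
  define d where "d = (\<lambda>k. \<sigma> * (p $ k)\<^sup>2 + (4 * C\<^sup>2) * (q $ k)\<^sup>2)"
  \<comment> \<open>Since \<open>c\<close> is a unit with real part \<open>C\<close>, its conjugate
    and all its powers reduce to real combinations of \<open>1\<close> and \<open>c\<close>.\<close>
  have c2: "c\<^sup>2 = of_real (2 * C) * c - 1"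
    by (simp add: cCS complex_eq_iff power2_eq_square S2)
  have cc: "cnj c = of_real (2 * C) - c"
    by (simp add: cCS complex_eq_iff)
  have c3: "c ^ 3 = of_real (4 * C\<^sup>2 - 1) * c - of_real (2 * C)"
  proof -
    have "c ^ 3 = c * (of_real (2 * C) * c - 1)" 
      unfolding c2[symmetric] by (simp add: power3_eq_cube power2_eq_square)
    also have "\<dots> = of_real (2 * C) * c\<^sup>2 - c" by (simp add: algebra_simps power2_eq_square)
    also have "\<dots> = of_real (2 * C) * (of_real (2 * C) * c - 1) - c" by (simp only: c2)
    finally show ?thesis by (simp add: algebra_simps power2_eq_square)
  qed
  have "(\<Sum>k\<in>UNIV. of_real (p $ k) * s $ k) = s $ u + of_real (- 2 * C) * s $ j1 + s $ j2"
    using js by (subst sum_UNIV_distinct_list[OF js]) (auto simp: p_def)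
  then have p0: "(\<Sum>k\<in>UNIV. of_real (p $ k) * s $ k) = 0"
    by (simp add: sj c2 algebra_simps)
  have "(\<Sum>k\<in>UNIV. of_real (q $ k) * s $ k) =
      of_real (6 * C) * s $ u - 2 * s $ j - of_real (4 * C\<^sup>2 + 1) * s $ j1 + s $ j3"
    using js by (subst sum_UNIV_distinct_list[OF js]) (auto simp: q_def algebra_simps)
  then have q0: "(\<Sum>k\<in>UNIV. of_real (q $ k) * s $ k) = 0"
    by (simp add: sj c3 cc algebra_simps)
  have d_vals: "d u = \<sigma> + 144 * C ^ 4" "d j = 16 * C\<^sup>2" "d j1 = 4 * C\<^sup>2 * (36 * C\<^sup>2 - 5)"
    "d j2 = \<sigma>" "d j3 = 4 * C\<^sup>2"
    using js by (auto simp: d_def p_def q_def \<sigma>_def algebra_simps power2_eq_square power4_eq_xxxx)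
  have d_out: "d k = 0" if "k \<notin> set [u, j, j1, j2, j3]" for k
    using that by (auto simp: d_def p_def q_def)
  have bal: "(\<Sum>k\<in>UNIV. d k) = 2 * d u"
    by (subst sum_UNIV_distinct_list[OF js])
      (auto simp: d_out d_vals \<sigma>_def algebra_simps power2_eq_square power4_eq_xxxx)
  have "(\<Sum>k\<in>UNIV. of_real (d k) * s $ k) =
      of_real (d u) * s $ u + of_real (d j) * s $ j + of_real (d j1) * s $ j1 + of_real (d j2) * s $ j2 + of_real (d j3) * s $ j3"
    by (subst sum_UNIV_distinct_list[OF js]) (auto simp: d_out algebra_simps)
  then have "(\<Sum>k\<in>UNIV. of_real (d k) * s $ k) - of_real (2 * d u) * s $ u =
      s $ u * (of_real (d j) * cnj c + of_real (d j1) * c + of_real (d j2) * c\<^sup>2 + of_real (d j3) * c ^ 3 - of_real (d u))"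
    by (simp add: sj algebra_simps)
  also have "of_real (d j) * cnj c + of_real (d j1) * c + of_real (d j2) * c\<^sup>2 + of_real (d j3) * c ^ 3 - of_real (d u)
      = c * (of_real (d j + d j3) * of_real (2 * C\<^sup>2 - 1) + of_real (d j1 + (d j2 - d u) * C)
           + \<i> * of_real (S * (2 * C * (d j3 - d j) + d j2 + d u)))"
  proof -
    \<comment> \<open>\<open>A\<close> and \<open>S * Y\<close> are the coordinates relative to
      \<open>c\<close>. Replacing \<open>\<i> * S\<close> by \<open>c - C\<close> leaves only
      coefficients of \<open>c\<close> and \<open>1\<close> to compare.\<close>
    define A where "A = (d j + d j3) * (2 * C\<^sup>2 - 1) + (d j1 + (d j2 - d u) * C)"
    define Y where "Y = 2 * C * (d j3 - d j) + d j2 + d u"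
    have iS: "\<i> * of_real (S * Y) = (c - of_real C) * of_real Y"
      by (simp add: cCS complex_eq_iff)
    have "c * (of_real A + \<i> * of_real (S * Y)) = of_real A * c + of_real Y * c\<^sup>2 - of_real (C * Y) * c"
      unfolding iS by (simp add: algebra_simps power2_eq_square)
    also have "\<dots> = of_real (A + C * Y) * c - of_real Y"
      unfolding c2 by (simp add: algebra_simps)
    also have "A + C * Y = d j1 - d j + 2 * C * d j2 + (4 * C\<^sup>2 - 1) * d j3"
      by (simp add: A_def Y_def algebra_simps power2_eq_square)
    finally show ?thesis
      by (simp add: A_def Y_def c2 c3 cc algebra_simps)
  qed
  also have "of_real (d j + d j3) * of_real (2 * C\<^sup>2 - 1) + of_real (d j1 + (d j2 - d u) * C)
           + \<i> * of_real (S * (2 * C * (d j3 - d j) + d j2 + d u))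
      = Complex (drift_re C) (drift_im C * S)"
    by (simp add: complex_eq_iff d_vals drift_re_def drift_im_def \<sigma>_def)
      (simp add: algebra_simps power2_eq_square power3_eq_cube power4_eq_xxxx)
  finally have *: "(\<Sum>k\<in>UNIV. of_real (d k) * s $ k) - of_real (2 * d u) * s $ u =
      s $ u * c * Complex (drift_re C) (drift_im C * S)" by (simp add: mult.assoc)
  have "(ctranspose H *v v) $ i \<bullet> ((\<Sum>k\<in>UNIV. of_real (d k) * s $ k) - of_real (2 * d u) * s $ u) \<le> 0"
    unfolding d_def
    by (rule esdr1t_tight_block[OF inj x tight u _ _ p0 q0]) (use \<sigma> bal in \<open>auto simp: d_def\<close>)
  then show ?thesis by (simp only: * C_def S_def)
qed

subsection \<open>PSK symbols\<close>

text \<open>Integer addresses of the symbols, read modulo M: neighbours and opposites are reached by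
  adding integers, with no case split at the wraparound.\<close>

definition psk_ix :: "int \<Rightarrow> 'k::{finite,linorder}" where
  "psk_ix n = (THE j. int (card {i. i < j}) = n mod int CARD('k))"

lemma bij_betw_card_less:
  "bij_betw (\<lambda>j::'k::{finite,linorder}. card {i. i < j}) UNIV {..<CARD('k)}"
proof -
  have "strict_mono (\<lambda>j::'k. card {i. i < j})"
    by (intro strict_monoI psubset_card_mono) auto
  then have inj: "inj (\<lambda>j::'k. card {i. i < j})"
    by (rule strict_mono_imp_inj_on)
  have "card {i. i < j} < CARD('k)" for j :: 'k
    by (intro psubset_card_mono) auto
  then have "range (\<lambda>j::'k. card {i. i < j}) = {..<CARD('k)}"
    by (intro card_subset_eq) (auto simp: card_image[OF inj])
  then show ?thesis using inj by (simp add: bij_betw_def)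
qed

lemma card_less_psk_ix: "int (card {i. i < (psk_ix n :: 'k::{finite,linorder})}) = n mod int CARD('k)"
proof -
  have "nat (n mod int CARD('k)) \<in> range (\<lambda>j::'k. card {i. i < j})"
    by (simp add: bij_betw_imp_surj_on[OF bij_betw_card_less] nat_less_iff)
  then obtain j :: 'k where "nat (n mod int CARD('k)) = card {i. i < j}" by blast
  then have j: "int (card {i. i < j}) = n mod int CARD('k)"
    by (metis nat_0_le of_nat_0_less_iff pos_mod_sign zero_less_card_finite)
  have "j' = j" if "int (card {i. i < j'}) = n mod int CARD('k)" for j' :: 'k
    by (rule injD[OF bij_betw_imp_inj_on[OF bij_betw_card_less]]) (use that j in simp)
  with j show ?thesis
    unfolding psk_ix_def by (rule theI)
qed

lemma psk_ix_eq_iff: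
  "(psk_ix n :: 'k::{finite,linorder}) = psk_ix n' \<longleftrightarrow> n mod int CARD('k) = n' mod int CARD('k)"
  by (metis card_less_psk_ix psk_ix_def)

lemma psk_ix_add_ne:
  assumes "k \<noteq> k'" "\<bar>k - k'\<bar> < int CARD('k)"
  shows "(psk_ix (n + k) :: 'k::{finite,linorder}) \<noteq> psk_ix (n + k')"
proof
  assume "(psk_ix (n + k) :: 'k) = psk_ix (n + k')"
  then have "int CARD('k) dvd k - k'"
    by (simp add: psk_ix_eq_iff mod_eq_dvd_iff)
  then show False
    using assms dvd_imp_le_int[of "k - k'" "int CARD('k)"] by simp
qed

lemma psk_ix_surj: "\<exists>n. j = psk_ix n"
proof
  have "card {i. i < j} < CARD('a)"
    using bij_betw_card_less[where 'k = 'a] by (auto simp: bij_betw_def)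
  then have "card {i. i < (psk_ix (int (card {i. i < j})) :: 'a)} = card {i. i < j}"
    using card_less_psk_ix[where 'k = 'a, of "int (card {i. i < j})"] by simp
  then show "j = psk_ix (int (card {i. i < j}))"
    using bij_betw_card_less[where 'k = 'a] unfolding bij_betw_def by (metis injD)
qed

lemma psk_psk_ix:
  "(psk :: complex^'k::{finite,linorder}) $ psk_ix n = cis (of_int n * (2 * pi / real CARD('k)))"
proof -
  let ?M = "CARD('k)" and ?r = "card {i. i < (psk_ix n :: 'k)}"
  have "n = int ?r + int ?M * (n div int ?M)"
    by (simp add: card_less_psk_ix)
  then have "real_of_int n = real ?r + real ?M * of_int (n div int ?M)"
    by (metis of_int_add of_int_mult of_int_of_nat_eq)
  then have "of_int n * (2 * pi / real ?M) = 2 * real ?r * pi / real ?M + 2 * pi * of_int (n div int ?M)"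
    by (simp add: field_simps)
  then have "cis (of_int n * (2 * pi / real ?M)) = cis (2 * real ?r * pi / real ?M)"
    by (simp add: cis_multiple_2pi flip: cis_mult)
  then show ?thesis
    by (simp add: psk_def cis_conv_exp)
qed

lemma psk_psk_ix_add:
  "(psk :: complex^'k::{finite,linorder}) $ psk_ix (n + k) =
    (psk :: complex^'k::{finite,linorder}) $ psk_ix n * cis (of_int k * (2 * pi / real CARD('k)))"
  by (simp add: psk_psk_ix cis_mult distrib_right add_divide_distrib)

lemma inj_psk: "inj (($) (psk :: complex^'k::{finite,linorder}))"
proof (rule injI)
  fix j j' :: 'k
  assume eq: "psk $ j = psk $ j'"
  have lt: "card {i. i < j} < CARD('k)" for j :: 'k
    using bij_betw_card_less[where 'k = 'k] by (auto simp: bij_betw_def)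
  have "psk $ j = exp (2 * of_real pi * \<i> * of_nat (card {i. i < j}) / of_nat CARD('k))" for j :: 'k
    by (simp add: psk_def mult_ac)
  then have "card {i. i < j} mod CARD('k) = card {i. i < j'} mod CARD('k)"
    using eq by (simp add: complex_root_unity_eq)
  then have "card {i. i < j} = card {i. i < j'}" using lt by simp
  then show "j = j'"
    using bij_betw_card_less[where 'k = 'k] unfolding bij_betw_def by (metis injD)
qed

text \<open>The two symbols at the ends of the arc of length 2\<pi>/M that contains the argument of
  \<open>z\<close>.\<close>

definition nearest_symbols :: "complex \<Rightarrow> 'k::{finite,linorder} set" where
  "nearest_symbols z = (let n = \<lfloor>Arg z / (2 * pi / real CARD('k))\<rfloor> in {psk_ix n, psk_ix (n + 1)})"

lemma card_nearest_symbols: "card (nearest_symbols z) \<le> 2"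
  by (simp add: nearest_symbols_def Let_def card_insert_if)

lemma inner_rcis_cis: "rcis r \<psi> \<bullet> (cis \<alpha> * Complex b a) = r * (b * cos (\<psi> - \<alpha>) + a * sin (\<psi> - \<alpha>))"
  by (simp add: inner_complex_def rcis_def cos_diff sin_diff algebra_simps)

text \<open>Let \<phi> be the angle from \<open>x $ i\<close> to \<open>z\<close>. The opposite
  symbol gives \<open>\<bar>\<phi>\<bar> \<le> pi / 2\<close>, which for M = 4 is already one step
  \<theta>; for larger M the two sector inequalities exclude what lies beyond \<theta>. A symbol
  within one step of \<open>z\<close>, with \<open>z\<close> on no symbol ray, is an end of the arc
  around \<open>z\<close>.\<close>

lemma esdr1t_tight_psk:
  fixes H :: "complex^'n^'m" and x :: "complex^'n" and v :: "complex^'m" and i :: 'n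
    and u :: "'k::{finite,linorder}" and s :: "complex^'k::{finite,linorder}"
  defines "z \<equiv> (ctranspose H *v v) $ i" and "s \<equiv> psk"
  assumes M: "CARD('k) = 2 ^ b" "4 \<le> CARD('k)"
    and x: "\<And>i. x $ i \<in> range (($) s)" and u: "x $ i = s $ u"
    and tight: "esdr1t_tight s H (H *v x + v) x"
    and generic: "\<And>j. Im (cnj (s $ j) * z) \<noteq> 0"
  shows "u \<in> nearest_symbols z"
proof -
  let ?M = "CARD('k)"
  define \<theta> where "\<theta> = 2 * pi / real ?M"
  define \<psi> where "\<psi> = Arg z"
  have inj: "inj (($) s)" by (simp add: s_def inj_psk)
  have s_ix: "s $ psk_ix n = cis (of_int n * \<theta>)" for n
    by (simp add: s_def psk_psk_ix \<theta>_def)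
  have \<theta>: "0 < \<theta>" "real ?M * \<theta> = 2 * pi" by (simp_all add: \<theta>_def)
  have z0: "z \<noteq> 0" using generic by fastforce
  have z: "z = rcis (norm z) \<psi>" by (simp add: \<psi>_def rcis_cmod_Arg)
  obtain n0 where n0: "u = psk_ix n0" using psk_ix_surj by blast
  \<comment> \<open>Among the addresses of \<open>u\<close>, which differ by multiples of M,
    rounding selects the one that brings \<phi> into [-\<pi>, \<pi>].\<close>
  define y where "y = (\<psi> - of_int n0 * \<theta>) / (2 * pi)"
  define n where "n = n0 + int ?M * round y"
  define \<phi> where "\<phi> = \<psi> - of_int n * \<theta>"
  have un: "u = psk_ix n" by (simp add: n0 n_def psk_ix_eq_iff)
  have "\<phi> = 2 * pi * (y - of_int (round y))"
  proof -
    have "of_int n * \<theta> = of_int n0 * \<theta> + of_int (round y) * (2 * pi)"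
      unfolding \<theta>(2)[symmetric] by (simp add: n_def algebra_simps)
    moreover have "2 * pi * y = \<psi> - of_int n0 * \<theta>" by (simp add: y_def)
    ultimately show ?thesis by (simp add: \<phi>_def algebra_simps)
  qed
  moreover have "\<bar>y - of_int (round y)\<bar> \<le> 1 / 2"
    using of_int_round_abs_le[of y] by linarith
  ultimately have \<phi>pi: "\<bar>\<phi>\<bar> \<le> pi"
    using mult_left_mono[of "\<bar>y - of_int (round y)\<bar>" "1 / 2" "2 * pi"] by (simp add: abs_mult)
  \<comment> \<open>Evenness puts a symbol exactly half a turn away from
    \<open>s $ u\<close>.\<close>
  have ev: "even ?M"
    using M by (cases b) auto
  have "0 \<le> z \<bullet> s $ u"
    unfolding z_def
  proof (rule esdr1t_tight_opposite[OF inj x tight u])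
    have half: "real_of_int (int ?M div 2) = real ?M / 2"
      using ev by (metis of_nat_numeral of_int_of_nat_eq real_of_nat_div zdiv_int)
    show "s $ psk_ix (n + int ?M div 2) = - s $ u"
      using \<theta>(2) by (simp add: un s_def psk_psk_ix_add half flip: \<theta>_def)
    show "psk_ix (n + int ?M div 2) \<noteq> u"
      using psk_ix_add_ne[of "int ?M div 2" 0, where 'k = 'k, of n] M(2) un by simp
  qed
  then have "0 \<le> cos \<phi>"
    using inner_rcis_cis[of "norm z" \<psi> "of_int n * \<theta>" 1 0] z z0
    by (simp add: un s_ix \<phi>_def zero_le_mult_iff complex_of_real_def[symmetric] one_complex.code[symmetric])
  then have "0 \<le> cos \<bar>\<phi>\<bar>" by simp
  then have \<phi>2: "\<bar>\<phi>\<bar> \<le> pi / 2"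
    using \<phi>pi cos_lt_zero_pi[of "\<bar>\<phi>\<bar>"] pi_gt_zero by linarith
  have "\<bar>\<phi>\<bar> \<le> \<theta>"
  proof (cases "?M = 4")
    case True
    then show ?thesis using \<phi>2 by (simp add: \<theta>_def)
  next
    case False
    \<comment> \<open>As M is a power of two, leaving out 4 means at least 8, hence
      \<open>\<theta> \<le> pi / 4\<close>.\<close>
    have "b \<noteq> 0 \<and> b \<noteq> 1 \<and> b \<noteq> 2" using M False by (auto intro: ccontr)
    then have "2 ^ 3 \<le> (2 :: nat) ^ b" by (intro power_increasing) auto
    then have M8: "8 \<le> ?M" using M(1) by simp
    then have \<theta>4: "\<theta> \<le> pi / 4" by (simp add: \<theta>_def field_simps)
    define C where "C = cos \<theta>"
    have Ccos: "cos (pi / 4) \<le> C"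
      unfolding C_def using \<theta> \<theta>4 by (intro cos_monotone_0_pi_le) auto
    then have "0 < C" by (smt (verit) cos_45 real_sqrt_gt_zero divide_pos_pos zero_less_numeral)
    have "(cos (pi / 4))\<^sup>2 \<le> C\<^sup>2" using Ccos by (intro power_mono) (auto simp: cos_45)
    then have C2: "1 / 2 \<le> C\<^sup>2" by (simp add: cos_45 power_divide)
    have "C\<^sup>2 \<le> 1" by (simp add: C_def abs_square_le_1)
    note drift = drift_pos[OF C2 \<open>C\<^sup>2 \<le> 1\<close> \<open>0 < C\<close>]
    have sin: "0 < sin \<theta>" using \<theta> \<theta>4 by (intro sin_gt_zero) auto
    \<comment> \<open>The sign \<sigma> chooses the sense of rotation,
      \<open>c = cis (\<sigma> * \<theta>)\<close>, and so covers both mirror images.\<close>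
    have sector: "drift_re C * cos (\<phi> - of_int \<sigma> * \<theta>) + drift_im C * sin (of_int \<sigma> * \<theta>) * sin (\<phi> - of_int \<sigma> * \<theta>) \<le> 0"
      if \<sigma>: "\<sigma> = 1 \<or> \<sigma> = - 1" for \<sigma> :: int
    proof -
      let ?c = "cis (of_int \<sigma> * \<theta>)"
      have c: "Re ?c = C" using \<sigma> by (auto simp: C_def)
      have ix: "s $ psk_ix (n + k * \<sigma>) = s $ u * cis (of_int k * (of_int \<sigma> * \<theta>))" for k
        by (simp add: un s_ix cis_mult algebra_simps)
      have "z \<bullet> (s $ u * ?c * Complex (drift_re (Re ?c)) (drift_im (Re ?c) * Im ?c)) \<le> 0"
        unfolding z_def
      proof (rule esdr1t_tight_sector[OF inj x tight u,
            of "psk_ix (n + (- 1) * \<sigma>)" "psk_ix (n + 1 * \<sigma>)" "psk_ix (n + 2 * \<sigma>)" "psk_ix (n + 3 * \<sigma>)"])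
        \<comment> \<open>Offsets from -1 to 3 differ by at most 4, which is below M, so the five
          addresses are distinct modulo M.\<close>
        have "psk_ix (n + k * \<sigma>) \<noteq> (psk_ix (n + k' * \<sigma>) :: 'k)"
          if "k \<noteq> k'" "\<bar>k\<bar> + \<bar>k'\<bar> < 8" for k k' :: int
          using that M8 \<sigma> by (intro psk_ix_add_ne) auto
        then have "inj_on (\<lambda>k. psk_ix (n + k * \<sigma>) :: 'k) {- 1..3}"
          by (intro inj_onI) force
        then have "inj_on (\<lambda>k. psk_ix (n + k * \<sigma>) :: 'k) (set [0, - 1, 1, 2, 3])"
          by (rule inj_on_subset) auto
        then have "distinct (map (\<lambda>k. psk_ix (n + k * \<sigma>) :: 'k) [0, - 1, 1, 2, 3])"
          unfolding distinct_map by (rule conjI[rotated]) simp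
        then show "distinct [u, psk_ix (n + (- 1) * \<sigma>), psk_ix (n + 1 * \<sigma>), psk_ix (n + 2 * \<sigma>), psk_ix (n + 3 * \<sigma>)]"
          by (simp add: un)
        show "s $ psk_ix (n + (- 1) * \<sigma>) = s $ u * cnj ?c" unfolding ix by (simp add: cis_cnj)
        show "s $ psk_ix (n + 1 * \<sigma>) = s $ u * ?c" unfolding ix by simp
        show "s $ psk_ix (n + 2 * \<sigma>) = s $ u * ?c\<^sup>2" unfolding ix by (simp add: Complex.DeMoivre)
        show "s $ psk_ix (n + 3 * \<sigma>) = s $ u * ?c ^ 3" unfolding ix by (simp add: Complex.DeMoivre)
        show "1 / 2 \<le> (Re ?c)\<^sup>2" using c C2 by simp
      qed simp
      also have "s $ u * ?c = cis (of_int n * \<theta> + of_int \<sigma> * \<theta>)"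
        by (simp add: un s_ix cis_mult)
      finally have "norm z * (drift_re C * cos (\<psi> - (of_int n * \<theta> + of_int \<sigma> * \<theta>)) +
          drift_im C * Im ?c * sin (\<psi> - (of_int n * \<theta> + of_int \<sigma> * \<theta>))) \<le> 0"
        unfolding c by (subst (asm) z) (simp only: inner_rcis_cis)
      then show ?thesis
        using z0 by (simp add: \<phi>_def mult_le_0_iff diff_diff_eq)
    qed
    show ?thesis
    proof (rule ccontr)
      assume "\<not> ?thesis"
      then consider "\<theta> < \<phi>" | "\<phi> < - \<theta>" by linarith
      then show False
      proof cases
        case 1
        \<comment> \<open>Between \<theta> and \<pi>/2 both terms of the sector inequality are
          nonnegative and the sine term is positive.\<close>
        have "0 < sin (\<phi> - \<theta>)" "0 \<le> cos (\<phi> - \<theta>)"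
          using 1 \<theta> \<phi>2 \<phi>pi by (auto intro!: sin_gt_zero cos_ge_zero)
        then have "0 < drift_re C * cos (\<phi> - \<theta>) + drift_im C * sin \<theta> * sin (\<phi> - \<theta>)"
          using drift sin by (intro add_nonneg_pos) auto
        then show False using sector[of 1] by simp
      next
        case 2
        have "0 < sin (- \<phi> - \<theta>)" "0 \<le> cos (- \<phi> - \<theta>)"
          using 2 \<theta> \<phi>2 \<phi>pi by (auto intro!: sin_gt_zero cos_ge_zero)
        then have "0 < drift_re C * cos (- \<phi> - \<theta>) + drift_im C * sin \<theta> * sin (- \<phi> - \<theta>)"
          using drift sin by (intro add_nonneg_pos) auto
        moreover have "cos (- \<phi> - \<theta>) = cos (\<phi> + \<theta>)" "sin (- \<phi> - \<theta>) = - sin (\<phi> + \<theta>)"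
          using cos_minus[of "\<phi> + \<theta>"] sin_minus[of "\<phi> + \<theta>"] by simp_all
        ultimately show False using sector[of "- 1"] by simp
      qed
    qed
  qed
  then have "\<bar>\<psi> / \<theta> - of_int n\<bar> * \<theta> \<le> 1 * \<theta>"
    using \<theta> by (simp add: \<phi>_def abs_mult[symmetric] flip: abs_mult_pos) (simp add: field_simps)
  then have near: "\<bar>\<psi> / \<theta> - of_int n\<bar> \<le> 1"
    using \<theta>(1) by (simp only: mult_le_cancel_right_pos)
  \<comment> \<open>On a symbol ray three addresses would lie within one step; genericity rules this
    out.\<close>
  have "\<psi> / \<theta> \<noteq> of_int k" for k
  proof
    assume "\<psi> / \<theta> = of_int k"
    then have "\<psi> = of_int k * \<theta>" using \<theta> by (simp add: field_simps)
    then have "cnj (s $ psk_ix k) * z = of_real (norm z)"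
      by (subst z) (simp add: s_ix rcis_def cis_cnj cis_mult)
    then show False using generic[of "psk_ix k"] by simp
  qed
  then have "of_int \<lfloor>\<psi> / \<theta>\<rfloor> < \<psi> / \<theta>"
    using of_int_floor_le[of "\<psi> / \<theta>"] by (metis order_le_less)
  then have "n = \<lfloor>\<psi> / \<theta>\<rfloor> \<or> n = \<lfloor>\<psi> / \<theta>\<rfloor> + 1"
    using near by linarith
  then show ?thesis
    by (auto simp: nearest_symbols_def Let_def un \<psi>_def \<theta>_def)
qed

subsection \<open>Probability\<close>

lemma outer_axis_decomp:
  fixes T :: "real^'b^'a"
  shows "T = (\<Sum>e\<in>UNIV. \<Sum>f\<in>UNIV. T $ e $ f *\<^sub>R outer (axis e 1) (axis f 1))"
proof -
  have "(\<Sum>e\<in>UNIV. \<Sum>f\<in>UNIV. T $ e $ f * ((axis e 1 :: real^'a) $ i * (axis f 1 :: real^'b) $ j)) = T $ i $ j" for i j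
  proof -
    have "(\<Sum>f\<in>UNIV. T $ e $ f * ((axis e 1 :: real^'a) $ i * (axis f 1 :: real^'b) $ j)) =
        (if e = i then T $ i $ j else 0)" for e
      by (subst sum.remove[of _ j]) (auto simp: axis_def intro!: sum.neutral)
    then show ?thesis by simp
  qed
  then show ?thesis by (simp add: vec_eq_iff outer_def)
qed

lemma mat_inner_sum: "mat_inner A (\<Sum>i\<in>I. B i) = (\<Sum>i\<in>I. mat_inner A (B i))"
proof (induction I rule: infinite_finite_induct)
  case (insert i I)
  then show ?case by (simp add: mat_inner_add)
qed (simp_all add: mat_inner_def trace_def)

lemma continuous_on_matrix_vector_mult [continuous_intros]:
  fixes F :: "'a::topological_space \<Rightarrow> complex^'n^'m"
  assumes "continuous_on S F" "continuous_on S g"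
  shows "continuous_on S (\<lambda>p. F p *v g p)"
  unfolding matrix_vector_mult_def
  by (intro continuous_on_vec_lambda continuous_on_sum continuous_on_mult continuous_on_component assms)

text \<open>Expanding \<open>T\<close> in rank-one coordinate matrices writes the objective as a
  finite sum of inner products of vectors \<open>H *v w\<close> with fixed \<open>w\<close>, and one
  with \<open>r\<close>.\<close>

lemma continuous_on_esdr1t_objective:
  assumes "continuous_on S F" "continuous_on S g"
  shows "continuous_on S (\<lambda>p. esdr1t_objective s (F p) (g p) t T)"
proof -
  have *: "esdr1t_objective s H r t T =
      (\<Sum>e\<in>UNIV. \<Sum>f\<in>UNIV. T $ e $ f *
        ((H *v symbol_mix s (axis e 1)) \<bullet> (H *v symbol_mix s (axis f 1)))) -
      2 * (r \<bullet> (H *v symbol_mix s t))" for H r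
    unfolding esdr1t_objective_def
    by (subst outer_axis_decomp[of T])
      (simp add: mat_inner_sum mat_inner_scaleR mat_inner_Q_bar inner_c_bar)
  show ?thesis
    unfolding * by (intro continuous_intros assms)
qed

text \<open>With \<open>x\<close> fixed, neither the feasible set nor the candidate depends on
  \<open>(H, v)\<close>. Tightness is thus an intersection of closed conditions, one per competitor;
  closedness makes it Borel although there are uncountably many of them.\<close>

lemma closed_esdr1t_tight:
  fixes x :: "complex^'n" and s :: "complex^'k"
  shows "closed {(H :: complex^'n^'m, v). esdr1t_tight s H (H *v x + v) x}"
proof -
  let ?t = "t_star s x :: real^('n \<times> 'k)"
  let ?f = "\<lambda>t T (p :: (complex^'n^'m) \<times> (complex^'m)). esdr1t_objective s (fst p) (fst p *v x + snd p) t T"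
  have "closed {p. esdr1t_feasible ?t (outer ?t ?t) \<and>
      (\<forall>t' T'. esdr1t_feasible t' T' \<longrightarrow> ?f ?t (outer ?t ?t) p \<le> ?f t' T' p)}"
    by (intro closed_Collect_conj closed_Collect_all closed_Collect_imp closed_Collect_le
        closed_Collect_const open_Collect_const continuous_on_esdr1t_objective continuous_intros)
  moreover have "{(H :: complex^'n^'m, v). esdr1t_tight s H (H *v x + v) x} =
    {p. esdr1t_feasible ?t (outer ?t ?t) \<and>
      (\<forall>t' T'. esdr1t_feasible t' T' \<longrightarrow> ?f ?t (outer ?t ?t) p \<le> ?f t' T' p)}"
    by (auto simp: esdr1t_tight_def esdr1t_optimal_def)
  ultimately show ?thesis by simp
qed

section \<open>Almost sure genericity of the correlation\<close>

lemma AE_not_in_hyperplane: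
  fixes w :: "'a::euclidean_space"
  assumes "absolutely_continuous lborel N" "w \<noteq> 0"
  shows "AE y in N. w \<bullet> y \<noteq> 0"
proof -
  have "closed {y. w \<bullet> y = 0}" by (rule closed_hyperplane)
  then have "{y. w \<bullet> y = 0} \<in> null_sets lborel"
    using negligible_hyperplane[of w 0] assms(2)
    by (simp add: negligible_iff_null_sets null_sets_completion_iff)
  then have "{y. w \<bullet> y = 0} \<in> null_sets N"
    using assms(1) by (auto simp: absolutely_continuous_def)
  then show ?thesis by (rule AE_I') auto
qed

text \<open>For fixed \<open>H\<close> the quantity is a real linear form in \<open>v\<close> with
  coefficient vector \<open>?w H\<close>. Almost every \<open>H\<close> makes this vector nonzero,
  and then \<open>v\<close> almost surely avoids the hyperplane; the product measure combines the
  two.\<close>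

lemma AE_correlation_ne_0:
  fixes NH :: "(complex^'n^'m) measure" and Nv :: "(complex^'m) measure"
  assumes "prob_space NH" "prob_space Nv" "sets NH = sets borel" "sets Nv = sets borel"
    and ac: "absolutely_continuous lborel NH" "absolutely_continuous lborel Nv" and a: "a \<noteq> 0"
  shows "AE (H, v) in NH \<Otimes>\<^sub>M Nv. Im (cnj a * (ctranspose H *v v) $ i) \<noteq> 0"
proof -
  interpret NH: prob_space NH by fact
  interpret Nv: prob_space Nv by fact
  interpret pair_prob_space NH Nv ..
  let ?w = "\<lambda>H :: complex^'n^'m. H *v axis i (\<i> * a)"
  have Im_eq: "Im (cnj a * (ctranspose H *v v) $ i) = ?w H \<bullet> v" for H :: "complex^'n^'m" and v
  proof -
    have "?w H \<bullet> v = axis i (\<i> * a) \<bullet> (ctranspose H *v v)" by (simp add: inner_ctranspose)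
    then show ?thesis by (simp add: inner_axis' inner_complex_def)
  qed
  have sets_eq: "sets (NH \<Otimes>\<^sub>M Nv) = sets borel"
    using assms by (simp add: borel_prod[symmetric] cong: sets_pair_measure_cong)
  have sp: "space (NH \<Otimes>\<^sub>M Nv) = UNIV" using sets_eq_imp_space_eq[OF sets_eq] by simp
  have "open {p. ?w (fst p) \<bullet> snd p \<noteq> 0}"
    by (intro open_Collect_neq continuous_intros)
  then have meas: "{p \<in> space (NH \<Otimes>\<^sub>M Nv). ?w (fst p) \<bullet> snd p \<noteq> 0} \<in> sets (NH \<Otimes>\<^sub>M Nv)"
    by (simp add: sets_eq sp)
  \<comment> \<open>An arbitrary row: one entry of column \<open>i\<close> with nonzero real part
    already makes \<open>?w H\<close> nonzero.\<close>
  let ?k = "undefined :: 'm"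
  have "AE H in NH. axis ?k (axis i 1) \<bullet> H \<noteq> 0"
    by (rule AE_not_in_hyperplane[OF ac(1)]) (simp add: axis_eq_0_iff)
  then have "AE H in NH. AE v in Nv. ?w H \<bullet> v \<noteq> 0"
  proof eventually_elim
    case (elim H)
    then have "H $ ?k $ i \<noteq> 0" by (auto simp: inner_axis')
    moreover have "?w H $ ?k = H $ ?k $ i * (\<i> * a)"
      by (simp add: matrix_vector_mult_def axis_def if_distrib[of "\<lambda>y. _ * y"] cong: if_cong)
    ultimately have "?w H \<noteq> 0" using a by (metis zero_index mult_eq_0_iff complex_i_not_zero)
    then show ?case by (rule AE_not_in_hyperplane[OF ac(2)])
  qed
  then have "AE p in NH \<Otimes>\<^sub>M Nv. ?w (fst p) \<bullet> snd p \<noteq> 0"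
    by (intro AE_pair_measure meas) simp
  then show ?thesis unfolding Im_eq by (simp add: case_prod_beta)
qed

section \<open>Independence of one variable from a pair\<close>

context prob_space
begin

lemma indep_var3_pair_distr:
  assumes "indep_var3 MX X MY Y MZ Z"
  shows "distr M MY Y \<Otimes>\<^sub>M distr M MZ Z = distr M (MY \<Otimes>\<^sub>M MZ) (\<lambda>\<omega>. (Y \<omega>, Z \<omega>))"
proof -
  have rv [measurable]: "random_variable MY Y" "random_variable MZ Z"
    using assms by (simp_all add: indep_var3_def)
  interpret Y: prob_space "distr M MY Y" by (rule prob_space_distr) fact
  interpret Z: prob_space "distr M MZ Z" by (rule prob_space_distr) fact
  show ?thesis
  proof (rule pair_measure_eqI)
    fix A B assume A: "A \<in> sets (distr M MY Y)" and B: "B \<in> sets (distr M MZ Z)"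
    have "prob (\<Inter>j\<in>{1, 2}. (if j = (1::nat) then Y -` A \<inter> space M else Z -` B \<inter> space M)) =
        (\<Prod>j\<in>{1, 2}. prob (if j = (1::nat) then Y -` A \<inter> space M else Z -` B \<inter> space M))"
      using assms A B unfolding indep_var3_def
      by (intro indep_setsD[where I = "{0, 1, 2}"]) (auto, blast, blast)
    then have "prob ((Y -` A \<inter> space M) \<inter> (Z -` B \<inter> space M)) = prob (Y -` A \<inter> space M) * prob (Z -` B \<inter> space M)"
      by (simp add: Int_commute)
    moreover have "(\<lambda>\<omega>. (Y \<omega>, Z \<omega>)) -` (A \<times> B) \<inter> space M = (Y -` A \<inter> space M) \<inter> (Z -` B \<inter> space M)"
      by auto
    ultimately show "emeasure (distr M MY Y) A * emeasure (distr M MZ Z) B =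
        emeasure (distr M (MY \<Otimes>\<^sub>M MZ) (\<lambda>\<omega>. (Y \<omega>, Z \<omega>))) (A \<times> B)"
      using A B by (simp add: emeasure_distr emeasure_eq_measure ennreal_mult' del: vimage_Int)
  qed (auto intro: Y.sigma_finite_measure_axioms Z.sigma_finite_measure_axioms cong: sets_pair_measure_cong)
qed

text \<open>The preimages of rectangles in \<open>(Y, Z)\<close> form an intersection-stable system
  independent of \<open>X\<close>. Independence passes to the generated sigma-algebras, which
  contain the preimage of every product-measurable \<open>E\<close>.\<close>

lemma indep_var3_prob_pair:
  assumes ind: "indep_var3 MX X MY Y MZ Z" and A: "A \<in> sets MX" and E: "E \<in> sets (MY \<Otimes>\<^sub>M MZ)"
  shows "prob {\<omega> \<in> space M. X \<omega> \<in> A \<and> (Y \<omega>, Z \<omega>) \<in> E} =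
    prob {\<omega> \<in> space M. X \<omega> \<in> A} * prob {\<omega> \<in> space M. (Y \<omega>, Z \<omega>) \<in> E}"
proof -
  have rv: "random_variable MX X" "random_variable MY Y" "random_variable MZ Z"
    using ind by (simp_all add: indep_var3_def)
  let ?F = "{X -` A \<inter> space M |A. A \<in> sets MX}"
  let ?G = "{(Y -` B \<inter> space M) \<inter> (Z -` C \<inter> space M) |B C. B \<in> sets MY \<and> C \<in> sets MZ}"
  have F: "?F \<subseteq> events" and G: "?G \<subseteq> events"
    using rv by (auto intro!: sets.Int measurable_sets)
  have sub: "prob (\<Inter>j\<in>J. S j) = (\<Prod>j\<in>J. prob (S j))"
    if "J \<subseteq> {0, 1, 2}" "J \<noteq> {}" "S 0 \<in> ?F" "\<exists>B\<in>sets MY. S 1 = Y -` B \<inter> space M" "\<exists>C\<in>sets MZ. S 2 = Z -` C \<inter> space M"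
    for J and S :: "nat \<Rightarrow> 'a set"
  proof -
    have "finite J" using that(1) by (rule finite_subset) simp
    then show ?thesis
    using ind that unfolding indep_var3_def
    by (intro indep_setsD[where I = "{0, 1, 2}"]) (auto 0 3)
  qed
  have "indep_set ?F ?G"
  proof (rule indep_setI[OF F G])
    fix a b assume "a \<in> ?F" "b \<in> ?G"
    then obtain B C where b: "b = (Y -` B \<inter> space M) \<inter> (Z -` C \<inter> space M)" "B \<in> sets MY" "C \<in> sets MZ"
      by auto
    define S where "S = (\<lambda>j::nat. if j = 0 then a else if j = 1 then Y -` B \<inter> space M else Z -` C \<inter> space M)"
    have S: "S 0 \<in> ?F" "\<exists>B\<in>sets MY. S 1 = Y -` B \<inter> space M" "\<exists>C\<in>sets MZ. S 2 = Z -` C \<inter> space M"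
      using \<open>a \<in> ?F\<close> b by (auto simp: S_def)
    \<comment> \<open>The triple product rule splits off \<open>a\<close>; the rule for indices 1
      and 2 recombines the other two factors into \<open>prob b\<close>.\<close>
    have "prob (\<Inter>j\<in>{0, 1, 2}. S j) = (\<Prod>j\<in>{0, 1, 2}. prob (S j))"
      "prob (\<Inter>j\<in>{1, 2}. S j) = (\<Prod>j\<in>{1, 2}. prob (S j))"
      by (rule sub; use S in simp)+
    moreover have "(\<Inter>j\<in>{0, 1, 2}. S j) = a \<inter> b" "(\<Inter>j\<in>{1, 2}. S j) = b"
      by (auto simp: S_def b(1))
    ultimately show "prob (a \<inter> b) = prob a * prob b"
      by (simp add: S_def)
  qed
  moreover have "Int_stable ?F"
  proof (rule Int_stableI)
    fix a b assume "a \<in> ?F" "b \<in> ?F"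
    then obtain A B where "a = X -` A \<inter> space M" "b = X -` B \<inter> space M" "A \<in> sets MX" "B \<in> sets MX" by auto
    then show "a \<inter> b \<in> ?F" by (intro CollectI exI[of _ "A \<inter> B"]) auto
  qed
  moreover have "Int_stable ?G"
  proof (rule Int_stableI)
    fix a b assume "a \<in> ?G" "b \<in> ?G"
    then obtain A B C D where "a = (Y -` A \<inter> space M) \<inter> (Z -` B \<inter> space M)"
      "b = (Y -` C \<inter> space M) \<inter> (Z -` D \<inter> space M)"
      "A \<in> sets MY" "B \<in> sets MZ" "C \<in> sets MY" "D \<in> sets MZ" by auto
    then show "a \<inter> b \<in> ?G" by (intro CollectI exI[of _ "A \<inter> C"] exI[of _ "B \<inter> D"]) auto
  qed
  ultimately have "indep_set (sigma_sets (space M) ?F) (sigma_sets (space M) ?G)"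
    by (rule indep_set_sigma_sets)
  moreover have "X -` A \<inter> space M \<in> sigma_sets (space M) ?F"
    using A by (intro sigma_sets.Basic) auto
  moreover have "(\<lambda>\<omega>. (Y \<omega>, Z \<omega>)) -` E \<inter> space M \<in> sigma_sets (space M) ?G"
  proof -
    let ?N = "sigma (space M) ?G"
    have G': "?G \<subseteq> Pow (space M)" by auto
    \<comment> \<open>A preimage under \<open>Y\<close> alone is that of a rectangle whose other
      side is the whole space.\<close>
    have "Y \<in> measurable ?N MY"
    proof (rule measurableI)
      fix B assume "B \<in> sets MY"
      then show "Y -` B \<inter> space ?N \<in> sets ?N"
        using measurable_space[OF rv(3)] G'
        by (auto intro!: sigma_sets.Basic exI[of _ B] exI[of _ "space MZ"])
    qed (use rv(2) G' in \<open>auto dest: measurable_space\<close>)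
    moreover have "Z \<in> measurable ?N MZ"
    proof (rule measurableI)
      fix B assume "B \<in> sets MZ"
      then show "Z -` B \<inter> space ?N \<in> sets ?N"
        using measurable_space[OF rv(2)] G'
        by (auto intro!: sigma_sets.Basic exI[of _ B] exI[of _ "space MY"])
    qed (use rv(3) G' in \<open>auto dest: measurable_space\<close>)
    ultimately have "(\<lambda>\<omega>. (Y \<omega>, Z \<omega>)) \<in> measurable ?N (MY \<Otimes>\<^sub>M MZ)"
      by (rule measurable_Pair)
    from measurable_sets[OF this E] show ?thesis using G' by simp
  qed
  ultimately have "prob ((X -` A \<inter> space M) \<inter> ((\<lambda>\<omega>. (Y \<omega>, Z \<omega>)) -` E \<inter> space M)) =
      prob (X -` A \<inter> space M) * prob ((\<lambda>\<omega>. (Y \<omega>, Z \<omega>)) -` E \<inter> space M)"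
    by (rule indep_setD)
  moreover have "(X -` A \<inter> space M) \<inter> ((\<lambda>\<omega>. (Y \<omega>, Z \<omega>)) -` E \<inter> space M) =
      {\<omega> \<in> space M. X \<omega> \<in> A \<and> (Y \<omega>, Z \<omega>) \<in> E}"
    "X -` A \<inter> space M = {\<omega> \<in> space M. X \<omega> \<in> A}"
    "(\<lambda>\<omega>. (Y \<omega>, Z \<omega>)) -` E \<inter> space M = {\<omega> \<in> space M. (Y \<omega>, Z \<omega>) \<in> E}" by auto
  ultimately show ?thesis by simp
qed

end

section \<open>Counting compatible symbol vectors\<close>

theorem theorem3p9:
  fixes P :: "'w measure"
    and b :: nat
    and s :: "complex^'k::{finite,linorder}"
    and x :: "'w \<Rightarrow> complex^'n"
    and H :: "'w \<Rightarrow> complex^'n^'m"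
    and v r :: "'w \<Rightarrow> complex^'m"
  assumes "prob_space P"
    and "CARD('k) = 2 ^ b"
    and "CARD('k) \<ge> 4"
    and "s = psk"
    and "\<And>\<omega> i. \<omega> \<in> space P \<Longrightarrow> x \<omega> $ i \<in> range (($) s)"
    and "\<And>i j. measure P {\<omega> \<in> space P. x \<omega> $ i = s $ j} = 1 / real CARD('k)"
    and "prob_space.indep_vars P (\<lambda>_. borel) (\<lambda>i \<omega>. x \<omega> $ i) UNIV"
    and "prob_space.indep_var3 P borel x borel H borel v"
    and "absolutely_continuous lborel (distr P borel H)"
    and "absolutely_continuous lborel (distr P borel v)"
    and "\<And>\<omega>. r \<omega> = H \<omega> *v x \<omega> + v \<omega>"
  shows "{\<omega> \<in> space P. esdr1t_tight s (H \<omega>) (r \<omega>) (x \<omega>)} \<in> sets P \<and>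
    measure P {\<omega> \<in> space P. esdr1t_tight s (H \<omega>) (r \<omega>) (x \<omega>)} \<le> (2 / real CARD('k)) ^ CARD('n)"
proof -
  interpret prob_space P by fact
  note ind = assms(8)
  have rv [measurable]: "x \<in> borel_measurable P" "H \<in> borel_measurable P" "v \<in> borel_measurable P"
    using ind by (simp_all add: indep_var3_def)
  define word where "word u = (\<chi> i. s $ u i)" for u :: "'n \<Rightarrow> 'k"
  \<comment> \<open>Fixing the symbol vector to \<open>word u\<close> makes tightness an event of
    \<open>(H, v)\<close> alone, to which independence from \<open>x\<close> applies.\<close>
  define E where "E u = {(H :: complex^'n^'m, v). esdr1t_tight s H (H *v word u + v) (word u)}" for u
  define A where "A u = {\<omega> \<in> space P. x \<omega> \<in> {word u}}" for u
  define F where "F u = {\<omega> \<in> space P. (H \<omega>, v \<omega>) \<in> E u}" for u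
  let ?T = "{\<omega> \<in> space P. esdr1t_tight s (H \<omega>) (r \<omega>) (x \<omega>)}"
  have E [measurable]: "E u \<in> sets (borel \<Otimes>\<^sub>M borel)" for u
    unfolding borel_prod E_def by (intro borel_closed closed_esdr1t_tight)
  have A: "A u \<in> sets P" for u unfolding A_def by measurable
  have F: "F u \<in> sets P" for u unfolding F_def by measurable
  have T: "?T = (\<Union>u. A u \<inter> F u)"
  proof (intro equalityI subsetI)
    fix \<omega> assume \<omega>: "\<omega> \<in> ?T"
    then have "\<forall>i. \<exists>j. x \<omega> $ i = s $ j" using assms(5) by blast
    then obtain u where "\<forall>i. x \<omega> $ i = s $ u i" by metis
    then have "x \<omega> = word u" by (simp add: word_def vec_eq_iff)
    then show "\<omega> \<in> (\<Union>u. A u \<inter> F u)"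
      using \<omega> by (auto simp: A_def F_def E_def assms(11))
  qed (auto simp: A_def F_def E_def assms(11))
  have "(\<Union>u. A u \<inter> F u) \<in> sets P"
    using A F by (intro sets.finite_UN) auto
  moreover have "prob (\<Union>u. A u \<inter> F u) \<le> (2 / real CARD('k)) ^ CARD('n)"
  proof -
    have probA: "prob (A u) = (1 / real CARD('k)) ^ CARD('n)" for u
    proof -
      have "prob (\<Inter>i\<in>UNIV. (\<lambda>\<omega>. x \<omega> $ i) -` {s $ u i} \<inter> space P) =
          (\<Prod>i\<in>UNIV. prob ((\<lambda>\<omega>. x \<omega> $ i) -` {s $ u i} \<inter> space P))"
        by (rule indep_varsD[OF assms(7)]) auto
      moreover have "(\<Inter>i\<in>UNIV. (\<lambda>\<omega>. x \<omega> $ i) -` {s $ u i} \<inter> space P) = A u"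
        by (auto simp: A_def word_def vec_eq_iff)
      moreover have "(\<lambda>\<omega>. x \<omega> $ i) -` {s $ u i} \<inter> space P = {\<omega> \<in> space P. x \<omega> $ i = s $ u i}" for i
        by auto
      ultimately show ?thesis by (simp add: assms(6))
    qed
    have prob_AF: "prob (A u \<inter> F u) = prob (A u) * prob (F u)" for u
    proof -
      have "A u \<inter> F u = {\<omega> \<in> space P. x \<omega> \<in> {word u} \<and> (H \<omega>, v \<omega>) \<in> E u}"
        by (auto simp: A_def F_def)
      then show ?thesis
        using indep_var3_prob_pair[OF ind _ E, of "{word u}"] by (simp add: A_def F_def)
    qed
    have generic: "AE \<omega> in P. \<forall>i j. Im (cnj (s $ j) * (ctranspose (H \<omega>) *v v \<omega>) $ i) \<noteq> 0"
    proof -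
      have "AE \<omega> in P. Im (cnj (s $ j) * (ctranspose (H \<omega>) *v v \<omega>) $ i) \<noteq> 0" for i j
      proof -
        have "s $ j \<noteq> 0" by (simp add: assms(4) psk_def)
        then have "AE (H, v) in distr P borel H \<Otimes>\<^sub>M distr P borel v. Im (cnj (s $ j) * (ctranspose H *v v) $ i) \<noteq> 0"
          by (intro AE_correlation_ne_0 prob_space_distr rv assms) simp_all
        then have "AE (H, v) in distr P (borel \<Otimes>\<^sub>M borel) (\<lambda>\<omega>. (H \<omega>, v \<omega>)). Im (cnj (s $ j) * (ctranspose H *v v) $ i) \<noteq> 0"
          by (simp only: indep_var3_pair_distr[OF ind])
        from AE_distrD[OF _ this] show ?thesis by simp
      qed
      then show ?thesis by (simp add: AE_all_countable)
    qed
    \<comment> \<open>Generically, the words compatible with \<open>(H, v)\<close> lie in a product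
      of \<open>n\<close> sets of at most two symbols each, and these sets do not depend on the
      word.\<close>
    have count: "AE \<omega> in P. (\<Sum>u\<in>UNIV. indicator (F u) \<omega>) \<le> (2 :: real) ^ CARD('n)"
      using generic
    proof (rule AE_mp, intro AE_I2 impI)
      fix \<omega> assume g: "\<forall>i j. Im (cnj (s $ j) * (ctranspose (H \<omega>) *v v \<omega>) $ i) \<noteq> 0"
      let ?N = "\<lambda>i. nearest_symbols ((ctranspose (H \<omega>) *v v \<omega>) $ i) :: 'k set"
      have sub: "{u. \<omega> \<in> F u} \<subseteq> PiE UNIV ?N"
      proof
        fix u assume "u \<in> {u. \<omega> \<in> F u}"
        then have tight: "esdr1t_tight s (H \<omega>) (H \<omega> *v word u + v \<omega>) (word u)"
          by (simp add: F_def E_def)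
        have "u i \<in> ?N i" for i
          by (rule esdr1t_tight_psk[OF assms(2,3) _ _ tight[unfolded assms(4)]])
            (use g in \<open>auto simp: word_def assms(4)\<close>)
        then show "u \<in> PiE UNIV ?N" by auto
      qed
      have "(\<Sum>u\<in>UNIV. indicator (F u) \<omega>) = real (card {u. \<omega> \<in> F u})"
        by (simp add: indicator_def sum.If_cases)
      also have "card {u. \<omega> \<in> F u} \<le> card (PiE UNIV ?N)"
        by (rule card_mono[OF _ sub]) simp
      also have "\<dots> = (\<Prod>i\<in>UNIV. card (?N i))" by (simp add: card_PiE)
      also have "\<dots> \<le> (\<Prod>i\<in>(UNIV :: 'n set). 2)"
        by (intro prod_mono) (simp add: card_nearest_symbols)
      finally show "(\<Sum>u\<in>UNIV. indicator (F u) \<omega>) \<le> (2 :: real) ^ CARD('n)" by simp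
    qed
    \<comment> \<open>Integrating the count bounds the sum of these probabilities by
      \<open>2 ^ n\<close>, with no estimate for a single \<open>F u\<close>.\<close>
    have "(\<Sum>u\<in>UNIV. prob (F u)) = expectation (\<lambda>\<omega>. \<Sum>u\<in>UNIV. indicator (F u) \<omega>)"
      using F by (subst Bochner_Integration.integral_sum) (auto simp: less_top[symmetric])
    also have "\<dots> \<le> expectation (\<lambda>\<omega>. 2 ^ CARD('n))"
      using F count by (intro integral_mono_AE) (auto simp: less_top[symmetric])
    finally have sumF: "(\<Sum>u\<in>UNIV. prob (F u)) \<le> 2 ^ CARD('n)" by (simp add: prob_space)
    have "prob (\<Union>u. A u \<inter> F u) \<le> (\<Sum>u\<in>UNIV. prob (A u \<inter> F u))"
      using A F by (intro finite_measure_subadditive_finite) auto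
    also have "\<dots> = (1 / real CARD('k)) ^ CARD('n) * (\<Sum>u\<in>UNIV. prob (F u))"
      by (simp add: prob_AF probA sum_distrib_left)
    also have "\<dots> \<le> (1 / real CARD('k)) ^ CARD('n) * 2 ^ CARD('n)"
      by (intro mult_left_mono sumF) simp
    finally show ?thesis by (simp add: power_divide)
  qed
  ultimately show ?thesis unfolding T by blast
qed

end
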